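(* Let $f\in\mathbb{Z}[x,z]$ be a homogeneous irreducible polynomial of degree $3$. Let $$\delta(N)=\#\{(x,z)\in\mathbb{Z}^2:|x|,|z|\le N,\ \gcd(x,z)=1,\ \exists\text{ prime }p>N\text{ s.t. }p^2\mid f(x,z)\}.$$ Then $\delta(N)\ll N^{4/3}(\log N)^A$, where $A$ and the implied constant depend only on $f$.
   Context: Here $N\ge2$ is an integer. *)

theory Defs
  imports Complex_Main "HOL-Computational_Algebra.Computational_Algebra"
begin

text \<open>
  The ring \<open>\<int>[x,z]\<close> is represented as \<open>(\<int>[x])[z]\<close>, i.e. by the type \<^typ>\<open>int poly poly\<close>:
  the coefficient of the monomial \<open>x\<^sup>i z\<^sup>j\<close> of \<open>f\<close> is \<open>coeff (coeff f j) i\<close>.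
\<close>

definition eval2 :: "'a::comm_semiring_1 poly poly \<Rightarrow> 'a \<Rightarrow> 'a \<Rightarrow> 'a" where
  "eval2 f x z = poly (poly f [:z:]) x"

lemma eval2_altdef:
  "eval2 f x z = (\<Sum>j\<le>degree f. \<Sum>i\<le>degree (coeff f j). coeff (coeff f j) i * x ^ i * z ^ j)"
  by (simp add: eval2_def poly_altdef[of f] poly_sum poly_power poly_altdef[of "coeff f _"] sum_distrib_right)

text \<open>
  The zero polynomial is homogeneous of every degree; a nonzero polynomial satisfying
  \<open>homogeneous2 d\<close> has total degree exactly \<open>d\<close>.
\<close>

definition homogeneous2 :: "nat \<Rightarrow> 'a::zero poly poly \<Rightarrow> bool" where
  "homogeneous2 d f \<longleftrightarrow> (\<forall>i j. coeff (coeff f j) i \<noteq> 0 \<longrightarrow> i + j = d)"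

definition large_square_points :: "int poly poly \<Rightarrow> nat \<Rightarrow> (int \<times> int) set" where
  "large_square_points f N =
     {(x, z). \<bar>x\<bar> \<le> int N \<and> \<bar>z\<bar> \<le> int N \<and> gcd x z = 1 \<and>
              (\<exists>p::nat. prime p \<and> p > N \<and> (int p)\<^sup>2 dvd eval2 f x z)}"

lemma finite_large_square_points: "finite (large_square_points f N)"
  by (rule finite_subset[of _ "{- int N..int N} \<times> {- int N..int N}"])
     (auto simp: large_square_points_def)

definition delta :: "int poly poly \<Rightarrow> nat \<Rightarrow> nat" where
  "delta f N = card (large_square_points f N)"

end

theory Submission
  imports Defs "HOL-Number_Theory.Cong"
begin

text \<open>
  Multiplying by \<open>a\<^sup>2\<close>, where \<open>a\<close> is the coefficient of \<open>x\<^sup>3\<close>, turns \<open>f\<close> into the norm form of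
  \<open>X - z \<omega>\<close> with \<open>X = a x\<close> and \<open>\<omega>\<close> a cubic algebraic integer.

  For \<open>N < p \<le> N powr (4/3)\<close> the ratio \<open>X / z\<close> takes at most three values modulo \<open>p\<close>, each lifting
  uniquely modulo \<open>p\<^sup>2\<close>. Two points with the same ratio have a determinant divisible by
  \<open>p\<^sup>2 > N\<^sup>2\<close>, so every square of side \<open>N / 2\<close> contains at most one of them up to sign, and there are
  \<open>O(1)\<close> points for each \<open>p\<close>.

  For \<open>p > N powr (4/3)\<close> the class group and the units are avoided as follows. The pigeonhole
  principle gives a nonzero \<open>\<beta> \<in> \<int>[\<omega>]\<close> in the prime ideal over \<open>p\<close> dividing \<open>X - z \<omega>\<close>, with
  coordinates at most \<open>p powr (1/3)\<close>. Let \<open>c\<close> be the product of the two other conjugates of \<open>\<beta>\<close>.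
  Then \<open>\<alpha> = (X - z \<omega>) c\<^sup>2 / p\<^sup>2\<close> lies in \<open>\<int>[\<omega>]\<close>, has coordinates \<open>O(N p powr (-2/3)) = O(N powr (1/9))\<close>,
  and \<open>p\<^sup>2 \<alpha> \<beta>\<^sup>2\<close> is \<open>(X - z \<omega>)\<close> times the square of the norm of \<open>\<beta>\<close>. Hence \<open>\<alpha>\<close> and \<open>\<beta>\<close> determine
  \<open>(x, z)\<close> up to sign, there are \<open>O(N powr (1/3))\<close> possible \<open>\<alpha>\<close>, and for each of them the vanishing of
  the \<open>\<omega>\<^sup>2\<close>-coordinate of \<open>\<alpha> \<beta>\<^sup>2\<close> confines \<open>\<beta>\<close> to a conic in a box of side \<open>O(N powr (1/2))\<close>, which
  leaves \<open>O(N)\<close> possibilities.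
\<close>

section \<open>Cubic forms without rational zeros\<close>

lemma homogeneous_cubic_form:
  fixes f :: "int poly poly"
  assumes "homogeneous2 3 f"
  obtains a b c d where "f = [:[:0,0,0,a:], [:0,0,b:], [:0,c:], [:d:]:]"
proof
  show "f = [:[:0,0,0,coeff (coeff f 0) 3:], [:0,0,coeff (coeff f 1) 2:],
              [:0,coeff (coeff f 2) 1:], [:coeff (coeff f 3) 0:]:]"
  proof (intro poly_eqI)
    fix j i :: nat
    have z: "coeff (coeff f j) i = 0" if "i + j \<noteq> 3" for i j :: nat
      using assms that by (auto simp: homogeneous2_def)
    consider "j = 0" | "j = 1" | "j = 2" | "j = 3" | "j > 3" by linarith
    then show "coeff (coeff f j) i =
      coeff (coeff [:[:0,0,0,coeff (coeff f 0) 3:], [:0,0,coeff (coeff f 1) 2:],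
              [:0,coeff (coeff f 2) 1:], [:coeff (coeff f 3) 0:]:] j) i"
      by cases (auto simp: z coeff_pCons numeral_eq_Suc split: nat.splits)
  qed
qed

text \<open>Gauss's lemma by hand: a nontrivial zero, reduced to lowest terms (r', s'), splits off
  the linear factor s' x - r' z with an integer quotient u0 x^2 + u1 x z + u2 z^2, and neither
  factor is a unit.\<close>

lemma irreducible_cubic_form_no_zero:
  fixes a b c d :: int
  assumes irr: "irreducible [:[:0,0,0,a:], [:0,0,b:], [:0,c:], [:d:]:]"
    and zero: "a * r ^ 3 + b * r ^ 2 * s + c * r * s ^ 2 + d * s ^ 3 = 0"
  shows "r = 0 \<and> s = 0"
proof (rule ccontr)
  assume nz: "\<not> (r = 0 \<and> s = 0)"
  have lin: False if "s' * u0 = a" "s' * u1 - r' * u0 = b" "s' * u2 - r' * u1 = c" "- r' * u2 = d"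
      and "\<not> (r' = 0 \<and> s' = 0)" for r' s' u0 u1 u2
  proof -
    have "[:[:0,0,0,a:], [:0,0,b:], [:0,c:], [:d:]:] =
          [:[:0,s':], [:-r':]:] * [:[:0,0,u0:], [:0,u1:], [:u2:]:]"
      using that(1-4) by (simp add: algebra_simps)
    with irr have "[:[:0,s':], [:-r':]:] dvd 1 \<or> [:[:0,0,u0:], [:0,u1:], [:u2:]:] dvd 1"
      by (metis irreducibleD)
    moreover have "[:[:0,0,0,a:], [:0,0,b:], [:0,c:], [:d:]:] \<noteq> 0"
      using irr by auto
    ultimately show False
      using that by (auto simp: is_unit_poly_iff split: if_splits)
  qed
  show False
  proof (cases "s = 0")
    case True
    with zero nz have "a = 0" by simp
    \<comment> \<open>The factor split off here is z itself.\<close>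
    then show False using lin[of 0 b c "-1" d] by simp
  next
    case False
    define e where "e = gcd r s"
    have e: "e \<noteq> 0" using False by (simp add: e_def)
    obtain r' s' where rs: "r = e * r'" "s = e * s'" "coprime r' s'"
      using gcd_coprime_exists[of r s] e by (metis e_def mult.commute)
    have s': "s' \<noteq> 0" using False rs by auto
    have "e ^ 3 * (a * r' ^ 3 + b * r' ^ 2 * s' + c * r' * s' ^ 2 + d * s' ^ 3) = 0"
      using zero unfolding rs by (simp add: algebra_simps power2_eq_square power3_eq_cube)
    then have z': "a * r' ^ 3 + b * r' ^ 2 * s' + c * r' * s' ^ 2 + d * s' ^ 3 = 0"
      using e by simp
    \<comment> \<open>Long division by s' x - r' z, one coefficient at a time: coprimality makes s'
      divide what each round has to divide, and cancelling s' prepares the next round.\<close>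
    have cop: "coprime s' (r' ^ k)" for k
      using rs(3) by (simp add: coprime_commute)
    have "a * r' ^ 3 = s' * (- (b * r' ^ 2 + c * r' * s' + d * s' ^ 2))"
      using z' by (simp add: algebra_simps power2_eq_square power3_eq_cube)
    then have "s' dvd a" using cop by (metis coprime_dvd_mult_left_iff dvd_triv_left)
    then obtain u0 where u0: "a = s' * u0" by (elim dvdE)
    have "s' * (u0 * r' ^ 3 + b * r' ^ 2 + c * r' * s' + d * s' ^ 2) = 0"
      using z' unfolding u0 by (simp add: algebra_simps power2_eq_square power3_eq_cube)
    then have z2: "u0 * r' ^ 3 + b * r' ^ 2 + c * r' * s' + d * s' ^ 2 = 0"
      using s' by simp
    then have "(b + r' * u0) * r' ^ 2 = s' * (- (c * r' + d * s'))"
      by (simp add: algebra_simps power2_eq_square power3_eq_cube)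
    then have "s' dvd b + r' * u0" using cop by (metis coprime_dvd_mult_left_iff dvd_triv_left)
    then obtain u1 where u1: "b + r' * u0 = s' * u1" by (elim dvdE)
    have "s' * (u1 * r' ^ 2 + c * r' + d * s') = r'\<^sup>2 * (s' * u1) + c * r' * s' + d * s' ^ 2"
      by (simp add: algebra_simps power2_eq_square)
    also have "\<dots> = 0"
      unfolding u1[symmetric] using z2 by (simp add: algebra_simps power2_eq_square power3_eq_cube)
    finally have z3: "u1 * r' ^ 2 + c * r' + d * s' = 0" using s' by simp
    then have "(c + r' * u1) * r' ^ 1 = s' * (- d)"
      by (simp add: algebra_simps power2_eq_square)
    then have "s' dvd c + r' * u1" using cop by (metis coprime_dvd_mult_left_iff dvd_triv_left)
    then obtain u2 where u2: "c + r' * u1 = s' * u2" by (elim dvdE)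
    have "s' * (u2 * r' + d) = r' * (s' * u2) + d * s'" by (simp add: algebra_simps)
    also have "\<dots> = 0"
      unfolding u2[symmetric] using z3 by (simp add: algebra_simps power2_eq_square)
    finally have "u2 * r' + d = 0" using s' by simp
    then show False using lin[of s' u0 u1 r' u2] u0 u1 u2 s' by (simp add: algebra_simps)
  qed
qed

lemma eval2_cubic_form:
  "eval2 [:[:0,0,0,a:], [:0,0,b:], [:0,c:], [:d:]:] x z =
     a * x ^ 3 + b * x\<^sup>2 * z + c * x * z\<^sup>2 + d * z ^ 3"
  for a b c d x z :: int
  by (simp add: eval2_def algebra_simps power2_eq_square power3_eq_cube)

section \<open>The monic cubic modulo primes and their squares\<close>

locale cubic_without_root =
  fixes g0 g1 g2 :: int
  assumes no_zero: "u ^ 3 + g2 * u\<^sup>2 * v + g1 * u * v\<^sup>2 + g0 * v ^ 3 = 0 \<Longrightarrow> u = 0 \<and> v = 0"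
begin

text \<open>Let g(t) = t^3 + g2 t^2 + g1 t + g0. Dividing 9 g by g' leaves the remainder m t + n
  with m = 6 g1 - 2 g2^2 and n = 9 g0 - g1 g2. The formula is the resultant of g' and this
  remainder, which equals -9 times the discriminant of g.\<close>

definition disc :: int where
  "disc = (6 * g1 - 2 * g2\<^sup>2)\<^sup>2 * g1 - 2 * g2 * (6 * g1 - 2 * g2\<^sup>2) * (9 * g0 - g1 * g2)
     + 3 * (9 * g0 - g1 * g2)\<^sup>2"

text \<open>A zero discriminant would make -n/m a rational root of g; if m = n = 0, then g is a cube
  with the root -g2/3.\<close>

lemma disc_nonzero: "disc \<noteq> 0"
proof
  assume D: "disc = 0"
  define m n where "m = 6 * g1 - 2 * g2\<^sup>2" and "n = 9 * g0 - g1 * g2"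
  have "9 * ((- n) ^ 3 + g2 * (- n)\<^sup>2 * m + g1 * (- n) * m\<^sup>2 + g0 * m ^ 3) = (g2 * m - 3 * n) * disc"
    unfolding m_def n_def disc_def by algebra
  with D no_zero[of "- n" m] have mn: "m = 0" "n = 0" by auto
  have "(- g2) ^ 3 + g2 * (- g2)\<^sup>2 * 3 + g1 * (- g2) * 3\<^sup>2 + g0 * 3 ^ 3 = 3 * n - g2 * m"
    unfolding m_def n_def by algebra
  then show False using no_zero[of "- g2" 3] mn by simp
qed

text \<open>Uniqueness in Hensel's lemma, homogenised: the difference of the two cubic values,
  scaled to the common denominator y = z z', is the determinant times the divided difference
  \<open>K\<close>. Modulo p both ratios agree, so \<open>K\<close> becomes g' at the common root;
  if p divided it, the root would be double and p would divide \<open>disc\<close>.\<close>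

lemma hensel:
  fixes p X z X' z' :: int
  assumes p: "prime p" and nd: "\<not> p dvd disc" "\<not> p dvd z" "\<not> p dvd z'"
    and X: "p\<^sup>2 dvd X ^ 3 + g2 * X\<^sup>2 * z + g1 * X * z\<^sup>2 + g0 * z ^ 3"
    and X': "p\<^sup>2 dvd X' ^ 3 + g2 * X'\<^sup>2 * z' + g1 * X' * z'\<^sup>2 + g0 * z' ^ 3"
    and W: "p dvd X * z' - X' * z"
  shows "p\<^sup>2 dvd X * z' - X' * z"
proof -
  define u v y where "u = X * z'" and "v = X' * z" and "y = z * z'"
  define K where "K = u\<^sup>2 + u * v + v\<^sup>2 + g2 * y * (u + v) + g1 * y\<^sup>2"
  have "(X * z' - X' * z) * K = z' ^ 3 * (X ^ 3 + g2 * X\<^sup>2 * z + g1 * X * z\<^sup>2 + g0 * z ^ 3)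
      - z ^ 3 * (X' ^ 3 + g2 * X'\<^sup>2 * z' + g1 * X' * z'\<^sup>2 + g0 * z' ^ 3)"
    unfolding K_def u_def v_def y_def by algebra
  then have "p\<^sup>2 dvd (X * z' - X' * z) * K" using X X' by (metis dvd_diff dvd_mult)
  moreover have "\<not> p dvd K"
  proof
    assume pK: "p dvd K"
    have pG: "p dvd X ^ 3 + g2 * X\<^sup>2 * z + g1 * X * z\<^sup>2 + g0 * z ^ 3"
      using X by (metis dvd_mult_left power2_eq_square)
    define m n where "m = 6 * g1 - 2 * g2\<^sup>2" and "n = 9 * g0 - g1 * g2"
    \<comment> \<open>The Euclidean algorithm for g and g' run backwards, homogenised at u / y:
      \<open>disc\<close> as a combination of g' and g.\<close>
    have e: "disc * y ^ 4 = (m\<^sup>2 * y\<^sup>2 + (3 * u + g2 * y) * (3 * m * u + (2 * g2 * m - 3 * n) * y)) *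
          (3 * u\<^sup>2 + 2 * g2 * u * y + g1 * y\<^sup>2)
        - (9 * z' ^ 3 * (3 * m * u + (2 * g2 * m - 3 * n) * y)) *
          (X ^ 3 + g2 * X\<^sup>2 * z + g1 * X * z\<^sup>2 + g0 * z ^ 3)"
      unfolding disc_def u_def y_def m_def n_def by algebra
    have "3 * u\<^sup>2 + 2 * g2 * u * y + g1 * y\<^sup>2 = K + (u - v) * (2 * u + v + g2 * y)"
      unfolding K_def by algebra
    then have "p dvd 3 * u\<^sup>2 + 2 * g2 * u * y + g1 * y\<^sup>2"
      using pK W by (simp add: u_def v_def)
    then have "p dvd disc * y ^ 4" unfolding e using pG
      by (intro dvd_diff dvd_mult)
    then show False using p nd
      by (auto simp: y_def prime_dvd_mult_iff prime_dvd_power_iff)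
  qed
  ultimately show ?thesis using p
    by (meson coprime_dvd_mult_left_iff coprime_power_left_iff prime_imp_coprime)
qed

text \<open>The quotient of g(r') - g(r) by r' - r vanishes modulo p at any two distinct roots.
  Subtracting two such relations that share a root shows that three distinct roots have sum -g2, so
  two of them determine any third.\<close>

lemma card_roots_mod_prime:
  fixes p :: int
  assumes "prime p"
  shows "card {r \<in> {0..<p}. p dvd r ^ 3 + g2 * r\<^sup>2 + g1 * r + g0} \<le> 3" (is "card ?S \<le> 3")
proof -
  have fac: "r' = r" if "r \<in> {0..<p}" "r' \<in> {0..<p}" "p dvd r' - r" for r r'
    using that zdvd_imp_le[of p "r' - r"] zdvd_imp_le[of p "r - r'"]
    by (cases "r' - r" "0::int" rule: linorder_cases) (auto simp: dvd_diff_commute)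
  have K: "p dvd r\<^sup>2 + r * r' + r'\<^sup>2 + g2 * (r + r') + g1" if "r \<in> ?S" "r' \<in> ?S" "r \<noteq> r'" for r r'
  proof -
    have "(r' - r) * (r\<^sup>2 + r * r' + r'\<^sup>2 + g2 * (r + r') + g1) =
       (r' ^ 3 + g2 * r'\<^sup>2 + g1 * r' + g0) - (r ^ 3 + g2 * r\<^sup>2 + g1 * r + g0)" by algebra
    also have "p dvd \<dots>" using that by (intro dvd_diff) blast+
    finally show ?thesis using fac[of r r'] that assms prime_dvd_multD by blast
  qed
  show ?thesis
  proof (cases "\<exists>r1 r2. r1 \<in> ?S \<and> r2 \<in> ?S \<and> r1 \<noteq> r2")
    case True
    then obtain r1 r2 where r: "r1 \<in> ?S" "r2 \<in> ?S" "r1 \<noteq> r2" by blast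
    have "?S \<subseteq> {r1, r2, (- g2 - r1 - r2) mod p}"
    proof
      fix r assume rS: "r \<in> ?S"
      show "r \<in> {r1, r2, (- g2 - r1 - r2) mod p}"
      proof (cases "r = r1 \<or> r = r2")
        case False
        have "(r - r2) * (r - (- g2 - r1 - r2)) =
          (r1\<^sup>2 + r1 * r + r\<^sup>2 + g2 * (r1 + r) + g1) - (r1\<^sup>2 + r1 * r2 + r2\<^sup>2 + g2 * (r1 + r2) + g1)"
          by algebra
        also have "p dvd \<dots>" using K[of r1 r] K[of r1 r2] r rS False by (intro dvd_diff) blast+
        finally have "p dvd r - (- g2 - r1 - r2)"
          using fac[of r2 r] r rS False assms prime_dvd_multD by blast
        then have "r mod p = (- g2 - r1 - r2) mod p" by (simp add: mod_eq_dvd_iff)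
        then show ?thesis using rS by simp
      qed auto
    qed
    then have "card ?S \<le> card {r1, r2, (- g2 - r1 - r2) mod p}" by (intro card_mono) auto
    also have "\<dots> \<le> 3" by (simp add: card_insert_if)
    finally show ?thesis .
  next
    case False
    have fin: "finite ?S" by (rule finite_subset[of _ "{0..<p}"]) auto
    have "card ?S \<le> 1"
      using False card_le_Suc0_iff_eq[OF fin] by auto
    then show ?thesis by simp
  qed
qed

end

section \<open>The ring generated by a root of a monic cubic\<close>

text \<open>Pigeonhole: of the (n + 1)^3 > p triples with entries from 0 to n, two give the same
  residue, and their difference is the relation.\<close>

lemma ex_small_linear_relation_mod:
  fixes p R :: int
  assumes "p > 0"
  obtains b1 b2 b3 :: int where
    "\<not> (b1 = 0 \<and> b2 = 0 \<and> b3 = 0)"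
    "\<bar>b1\<bar> ^ 3 \<le> p" "\<bar>b2\<bar> ^ 3 \<le> p" "\<bar>b3\<bar> ^ 3 \<le> p"
    "p dvd b1 + b2 * R + b3 * R\<^sup>2"
proof -
  \<comment> \<open>The integer part of the cube root of \<open>p\<close>: the box has more than
    \<open>p\<close> points, yet differences of entries have cubes at most \<open>p\<close>.\<close>
  define n where "n = (LEAST n::nat. p < (int n + 1) ^ 3)"
  have "p < (int (nat p) + 1) ^ 3"
    using assms power_increasing[of 1 3 "p + 1"] by simp
  then have n: "p < (int n + 1) ^ 3" unfolding n_def by (rule LeastI)
  have n': "int n ^ 3 \<le> p"
  proof (cases n)
    case 0
    then show ?thesis using assms by simp
  next
    case (Suc k)
    then have "\<not> p < (int k + 1) ^ 3" using not_less_Least[of k "\<lambda>n. p < (int n + 1) ^ 3"] unfolding n_def by simp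
    then show ?thesis using Suc by (simp add: add.commute)
  qed
  define S where "S = {0..int n} \<times> {0..int n} \<times> {0..int n}"
  define h where "h = (\<lambda>(i, j, k). (i + j * R + k * R\<^sup>2) mod p)"
  have cS: "card S = (n + 1) ^ 3"
    by (simp add: S_def card_cartesian_product power3_eq_cube nat_add_distrib)
  have "card (h ` S) \<le> card {0..<p}"
    using assms by (intro card_mono) (auto simp: h_def)
  also have "\<dots> < card S" using n assms unfolding cS
    by (metis card_atLeastLessThan_int diff_zero nat_less_iff of_nat_1 of_nat_add of_nat_power order_less_imp_le)
  finally have "\<not> inj_on h S" using card_image by (metis nat_neq_iff)
  then obtain i j k i' j' k' where
    S: "(i, j, k) \<in> S" "(i', j', k') \<in> S" and ne: "(i, j, k) \<noteq> (i', j', k')"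
    and eq: "h (i, j, k) = h (i', j', k')"
    unfolding inj_on_def by (metis prod_cases3)
  have le: "\<bar>x - y\<bar> ^ 3 \<le> p" if "x \<in> {0..int n}" "y \<in> {0..int n}" for x y :: int
  proof -
    have "\<bar>x - y\<bar> ^ 3 \<le> int n ^ 3" using that by (intro power_mono) auto
    with n' show ?thesis by linarith
  qed
  show ?thesis
  proof
    show "p dvd (i - i') + (j - j') * R + (k - k') * R\<^sup>2"
      using eq by (simp add: h_def mod_eq_dvd_iff algebra_simps)
  qed (use S ne le in \<open>auto simp: S_def\<close>)
qed

context cubic_without_root
begin

text \<open>A relation of degree one would give a rational root of g. One of degree two is divided
  into w^2 g; the remainder is a relation of degree at most one, hence zero. Stated for any complex
  root, so that it also covers the conjugates of \<omega>.\<close>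

lemma root_quadratic_independent:
  fixes \<rho> :: complex
  assumes root: "\<rho> ^ 3 + of_int g2 * \<rho>\<^sup>2 + of_int g1 * \<rho> + of_int g0 = 0"
    and zero: "of_int u + of_int v * \<rho> + of_int w * \<rho>\<^sup>2 = 0"
  shows "u = 0 \<and> v = 0 \<and> w = 0"
proof -
  have lin: "r0 = 0 \<and> r1 = 0" if "of_int r0 + of_int r1 * \<rho> = 0" for r0 r1 :: int
  proof -
    have "(of_int ((- r0) ^ 3 + g2 * (- r0)\<^sup>2 * r1 + g1 * (- r0) * r1\<^sup>2 + g0 * r1 ^ 3) :: complex)
      = of_int r1 ^ 3 * (\<rho> ^ 3 + of_int g2 * \<rho>\<^sup>2 + of_int g1 * \<rho> + of_int g0)"
      using that unfolding of_int_add of_int_mult of_int_power of_int_minus by algebra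
    then have "(- r0) ^ 3 + g2 * (- r0)\<^sup>2 * r1 + g1 * (- r0) * r1\<^sup>2 + g0 * r1 ^ 3 = 0"
      unfolding root by (metis mult_zero_right of_int_eq_0_iff)
    from no_zero[OF this] show ?thesis by simp
  qed
  show ?thesis
  proof (cases "w = 0")
    case True
    then show ?thesis using lin[of u v] zero by simp
  next
    case False
    \<comment> \<open>\<open>w\<^sup>2 g = (w t + e) (u + v t + w t\<^sup>2) + r1 t + r0\<close>\<close>
    define e where "e = g2 * w - v"
    define r1 where "r1 = g1 * w\<^sup>2 - u * w - e * v"
    define r0 where "r0 = g0 * w\<^sup>2 - e * u"
    have "of_int r0 + of_int r1 * \<rho> = 0"
      using root zero unfolding r0_def r1_def e_def
        of_int_add of_int_mult of_int_power of_int_minus of_int_diff by algebra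
    then have r: "r0 = 0" "r1 = 0" using lin by blast+
    \<comment> \<open>The division is exact now, so the linear quotient w t + e provides the
      rational root -e/w.\<close>
    have "(- e) ^ 3 + g2 * (- e)\<^sup>2 * w + g1 * (- e) * w\<^sup>2 + g0 * w ^ 3 = w * r0 - e * r1"
      unfolding r0_def r1_def e_def by algebra
    then show ?thesis using no_zero[of "- e" w] r False by simp
  qed
qed

end

section \<open>Coordinates and sizes in Z[\<omega>]\<close>

locale cubic_with_root = cubic_without_root +
  fixes \<omega> :: complex
  assumes root: "\<omega> ^ 3 + of_int g2 * \<omega>\<^sup>2 + of_int g1 * \<omega> + of_int g0 = 0"
begin

text \<open>Elements of Z[\<omega>] live inside the complex numbers: ring identities are inherited,
  and coordinates are recovered by linear independence.\<close>

definition ev :: "int \<Rightarrow> int \<Rightarrow> int \<Rightarrow> complex" where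
  "ev u v w = of_int u + of_int v * \<omega> + of_int w * \<omega>\<^sup>2"

lemma ev_eq_iff: "ev u v w = ev u' v' w' \<longleftrightarrow> u = u' \<and> v = v' \<and> w = w'"
proof
  assume "ev u v w = ev u' v' w'"
  then have "of_int (u - u') + of_int (v - v') * \<omega> + of_int (w - w') * \<omega>\<^sup>2 = 0"
    by (simp add: ev_def algebra_simps)
  from root_quadratic_independent[OF root this] show "u = u' \<and> v = v' \<and> w = w'" by simp
qed simp

lemma ev_eq_0_iff: "ev u v w = 0 \<longleftrightarrow> u = 0 \<and> v = 0 \<and> w = 0"
  using ev_eq_iff[of u v w 0 0 0] by (simp add: ev_def)

lemma ev_mult:
  "ev a1 a2 a3 * ev b1 b2 b3 =
    ev (a1 * b1 - g0 * (a2 * b3 + a3 * b2) + g2 * g0 * (a3 * b3))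
       (a1 * b2 + a2 * b1 - g1 * (a2 * b3 + a3 * b2) + (g2 * g1 - g0) * (a3 * b3))
       (a1 * b3 + a2 * b2 + a3 * b1 - g2 * (a2 * b3 + a3 * b2) + (g2\<^sup>2 - g1) * (a3 * b3))"
  unfolding ev_def of_int_add of_int_mult of_int_power of_int_minus of_int_diff
  using root by algebra

definition coeff_box :: "real \<Rightarrow> complex set" where
  "coeff_box B = {ev u v w | u v w. \<bar>real_of_int u\<bar> \<le> B \<and> \<bar>real_of_int v\<bar> \<le> B \<and> \<bar>real_of_int w\<bar> \<le> B}"

lemma coeff_boxI: "\<bar>real_of_int u\<bar> \<le> B \<Longrightarrow> \<bar>real_of_int v\<bar> \<le> B \<Longrightarrow> \<bar>real_of_int w\<bar> \<le> B \<Longrightarrow> ev u v w \<in> coeff_box B"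
  unfolding coeff_box_def by blast

lemma coeff_boxE:
  assumes "y \<in> coeff_box B"
  obtains u v w where "y = ev u v w" "\<bar>real_of_int u\<bar> \<le> B" "\<bar>real_of_int v\<bar> \<le> B" "\<bar>real_of_int w\<bar> \<le> B"
  using assms unfolding coeff_box_def by blast

lemma ev_in_coeff_box_iff:
  "ev u v w \<in> coeff_box B \<longleftrightarrow> \<bar>real_of_int u\<bar> \<le> B \<and> \<bar>real_of_int v\<bar> \<le> B \<and> \<bar>real_of_int w\<bar> \<le> B"
  by (auto intro: coeff_boxI elim!: coeff_boxE simp: ev_eq_iff)

lemma coeff_box_nonneg: "y \<in> coeff_box B \<Longrightarrow> 0 \<le> B"
  by (erule coeff_boxE) linarith

lemma coeff_box_mono: "y \<in> coeff_box B \<Longrightarrow> B \<le> B' \<Longrightarrow> y \<in> coeff_box B'"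
  by (erule coeff_boxE) (auto simp: ev_in_coeff_box_iff)

lemma coeff_box_add: "y \<in> coeff_box B \<Longrightarrow> y' \<in> coeff_box B' \<Longrightarrow> y + y' \<in> coeff_box (B + B')"
proof (elim coeff_boxE)
  fix u v w u' v' w'
  assume y: "y = ev u v w" "y' = ev u' v' w'"
    and b: "\<bar>real_of_int u\<bar> \<le> B" "\<bar>real_of_int v\<bar> \<le> B" "\<bar>real_of_int w\<bar> \<le> B"
     "\<bar>real_of_int u'\<bar> \<le> B'" "\<bar>real_of_int v'\<bar> \<le> B'" "\<bar>real_of_int w'\<bar> \<le> B'"
  have "y + y' = ev (u + u') (v + v') (w + w')" by (simp add: y ev_def algebra_simps)
  with b show ?thesis by (auto intro!: coeff_boxI)
qed

lemma coeff_box_of_int_mult: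
  assumes "y \<in> coeff_box B" "\<bar>real_of_int n\<bar> \<le> A"
  shows "of_int n * y \<in> coeff_box (A * B)"
proof -
  from assms(1) obtain u v w where y: "y = ev u v w" "\<bar>real_of_int u\<bar> \<le> B" "\<bar>real_of_int v\<bar> \<le> B" "\<bar>real_of_int w\<bar> \<le> B"
    by (rule coeff_boxE)
  have "of_int n * y = ev (n * u) (n * v) (n * w)" by (simp add: y ev_def algebra_simps)
  then show ?thesis using y assms(2) by (auto simp: ev_in_coeff_box_iff abs_mult intro!: mult_mono)
qed

text \<open>The maximum norm of the coordinates is submultiplicative up to a constant, because each
  coordinate of a product is a fixed bilinear form.\<close>

lemma coeff_box_mult:
  obtains M where "M > 0"
    "\<And>y y' B B'. y \<in> coeff_box B \<Longrightarrow> y' \<in> coeff_box B' \<Longrightarrow> y * y' \<in> coeff_box (M * B * B')"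
proof
  define H where "H = \<bar>real_of_int g0\<bar> + \<bar>real_of_int g1\<bar> + \<bar>real_of_int g2\<bar>"
  have H: "\<bar>real_of_int g0\<bar> \<le> H" "\<bar>real_of_int g1\<bar> \<le> H" "\<bar>real_of_int g2\<bar> \<le> H" "0 \<le> H"
    by (auto simp: H_def)
  \<comment> \<open>The sum of 3, 2 H and H^2 + H: at most three plain products, two weighted by a
    coefficient of g, and one weighted by a coordinate of \<omega>^4.\<close>
  show "3 + 3 * H + H\<^sup>2 > 0" using H by (simp add: add_pos_nonneg)
  fix y y' B B'
  assume y: "y \<in> coeff_box B" and y': "y' \<in> coeff_box B'"
  obtain a1 a2 a3 where a: "y = ev a1 a2 a3" "\<bar>real_of_int a1\<bar> \<le> B" "\<bar>real_of_int a2\<bar> \<le> B" "\<bar>real_of_int a3\<bar> \<le> B"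
    using y by (rule coeff_boxE)
  obtain b1 b2 b3 where b: "y' = ev b1 b2 b3" "\<bar>real_of_int b1\<bar> \<le> B'" "\<bar>real_of_int b2\<bar> \<le> B'" "\<bar>real_of_int b3\<bar> \<le> B'"
    using y' by (rule coeff_boxE)
  define D where "D = B * B'"
  have D0: "D \<ge> 0" using coeff_box_nonneg y y' by (auto simp: D_def)
  have m: "\<bar>real_of_int (x * x')\<bar> \<le> D" if "\<bar>real_of_int x\<bar> \<le> B" "\<bar>real_of_int x'\<bar> \<le> B'" for x x'
    unfolding D_def of_int_mult abs_mult using that by (intro mult_mono) auto
  have c3: "\<bar>real_of_int (a2 * b3 + a3 * b2)\<bar> \<le> 2 * D"
    using m[of a2 b3] m[of a3 b2] a b by simp
  have c4: "\<bar>real_of_int (a3 * b3)\<bar> \<le> D" using m a b by blast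
  have k: "\<bar>real_of_int (g * x)\<bar> \<le> A * A'" if "\<bar>real_of_int g\<bar> \<le> A" "\<bar>real_of_int x\<bar> \<le> A'" for g x A A'
    unfolding of_int_mult abs_mult using that by (intro mult_mono) auto
  have h1: "\<bar>real_of_int (g2 * g0)\<bar> \<le> H\<^sup>2 + H"
    using k[of g2 H g0 H] H by (simp add: power2_eq_square)
  have h2: "\<bar>real_of_int (g2 * g1 - g0)\<bar> \<le> H\<^sup>2 + H"
    using k[of g2 H g1 H] H unfolding of_int_diff power2_eq_square by linarith
  have h3: "\<bar>real_of_int (g2\<^sup>2 - g1)\<bar> \<le> H\<^sup>2 + H"
    using k[of g2 H g2 H] H(2,3) unfolding of_int_diff power2_eq_square by linarith
  have t: "\<bar>real_of_int (x - y + z)\<bar> \<le> (3 + 3 * H + H\<^sup>2) * B * B'"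
    if "\<bar>real_of_int x\<bar> \<le> 3 * D" "\<bar>real_of_int y\<bar> \<le> H * (2 * D)" "\<bar>real_of_int z\<bar> \<le> (H\<^sup>2 + H) * D" for x y z
    using that by (simp add: D_def algebra_simps)
  show "y * y' \<in> coeff_box ((3 + 3 * H + H\<^sup>2) * B * B')"
    unfolding a(1) b(1) ev_mult
  proof (intro coeff_boxI; intro t)
    show "\<bar>real_of_int (a1 * b1)\<bar> \<le> 3 * D" using m[of a1 b1] a b D0 by linarith
    show "\<bar>real_of_int (a1 * b2 + a2 * b1)\<bar> \<le> 3 * D"
      using m[of a1 b2] m[of a2 b1] a b D0 by simp
    show "\<bar>real_of_int (a1 * b3 + a2 * b2 + a3 * b1)\<bar> \<le> 3 * D"
      using m[of a1 b3] m[of a2 b2] m[of a3 b1] a b D0 unfolding of_int_add by linarith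
  qed (intro k c3 c4 h1 h2 h3 H)+
qed

text \<open>This is Z[\<omega>], written as a union of boxes so that membership supplies a bound on
  the coordinates.\<close>

definition int_span :: "complex set" where "int_span = (\<Union>B. coeff_box B)"

lemma ev_in_int_span: "ev u v w \<in> int_span"
  unfolding int_span_def
  using coeff_boxI[of u "\<bar>real_of_int u\<bar> + \<bar>real_of_int v\<bar> + \<bar>real_of_int w\<bar>" v w] by auto

lemma int_spanE:
  assumes "y \<in> int_span"
  obtains u v w where "y = ev u v w"
  using assms unfolding int_span_def by (auto elim: coeff_boxE)

lemma int_span_add: "y \<in> int_span \<Longrightarrow> y' \<in> int_span \<Longrightarrow> y + y' \<in> int_span"
  unfolding int_span_def using coeff_box_add by blast

lemma int_span_mult: "y \<in> int_span \<Longrightarrow> y' \<in> int_span \<Longrightarrow> y * y' \<in> int_span"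
  by (elim int_spanE) (simp add: ev_mult ev_in_int_span)

lemma int_span_of_int: "of_int n \<in> int_span"
  using ev_in_int_span[of n 0 0] by (simp add: ev_def)

lemma int_span_1: "1 \<in> int_span" using int_span_of_int[of 1] by simp

lemma int_span_numeral: "numeral n \<in> int_span" using int_span_of_int[of "numeral n"] by simp

lemma int_span_root: "\<omega> \<in> int_span"
  using ev_in_int_span[of 0 1 0] by (simp add: ev_def)

lemma int_span_minus: "y \<in> int_span \<Longrightarrow> - y \<in> int_span"
  using int_span_mult[OF int_span_of_int[of "-1"]] by fastforce

lemma int_span_diff: "y \<in> int_span \<Longrightarrow> y' \<in> int_span \<Longrightarrow> y - y' \<in> int_span"
  using int_span_add[of y "- y'"] int_span_minus[of y'] by simp

lemma int_span_power: "y \<in> int_span \<Longrightarrow> y ^ n \<in> int_span"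
  by (induction n) (auto intro: int_span_1 int_span_mult)

lemmas int_span_intros = int_span_add int_span_mult int_span_of_int int_span_1 int_span_numeral int_span_root int_span_minus int_span_diff int_span_power

section \<open>Conjugates, norms and the removal of p^2\<close>

definition conj_sum :: complex where "conj_sum = - of_int g2 - \<omega>"

text \<open>Vieta for g(t) / (t - \<omega>) = t^2 - \<open>conj_sum\<close> t +
  \<open>conj_prod\<close>: the sum and the product of the other two roots, expressed in
  \<omega>.\<close>

definition conj_prod :: complex where "conj_prod = \<omega>\<^sup>2 + of_int g2 * \<omega> + of_int g1"

text \<open>The product of the values of b1 + b2 t + b3 t^2 at the other two roots, expanded in
  their symmetric functions so that it visibly lies in Z[\<omega>].\<close>

definition cofactor :: "int \<Rightarrow> int \<Rightarrow> int \<Rightarrow> complex" where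
  "cofactor b1 b2 b3 = of_int (b1\<^sup>2) + of_int (b1 * b2) * conj_sum
     + of_int (b1 * b3) * (conj_sum\<^sup>2 - 2 * conj_prod) + of_int (b2\<^sup>2) * conj_prod
     + of_int (b2 * b3) * (conj_sum * conj_prod) + of_int (b3\<^sup>2) * conj_prod\<^sup>2"

definition nrm :: "int \<Rightarrow> int \<Rightarrow> int \<Rightarrow> int" where
  "nrm b1 b2 b3 = b1 ^ 3 - b1\<^sup>2 * b2 * g2 + b1\<^sup>2 * b3 * (g2\<^sup>2 - 2 * g1) + b1 * b2\<^sup>2 * g1
     + b1 * b2 * b3 * (3 * g0 - g1 * g2) + b1 * b3\<^sup>2 * (g1\<^sup>2 - 2 * g0 * g2) - b2 ^ 3 * g0
     + b2\<^sup>2 * b3 * g0 * g2 - b2 * b3\<^sup>2 * g0 * g1 + b3 ^ 3 * g0\<^sup>2"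

lemma ev_mult_cofactor: "ev b1 b2 b3 * cofactor b1 b2 b3 = of_int (nrm b1 b2 b3)"
  unfolding ev_def cofactor_def nrm_def conj_sum_def conj_prod_def
    of_int_add of_int_mult of_int_power of_int_minus of_int_diff of_int_numeral
  using root by algebra

text \<open>The norm is the product of the values of b1 + b2 t + b3 t^2 at the three roots of g, and
  linear independence makes each value nonzero.\<close>

lemma nrm_nonzero:
  assumes "\<not> (b1 = 0 \<and> b2 = 0 \<and> b3 = 0)"
  shows "nrm b1 b2 b3 \<noteq> 0"
proof -
  \<comment> \<open>The quadratic formula gives the other two roots.\<close>
  define d where "d = csqrt (conj_sum\<^sup>2 - 4 * conj_prod)"
  define \<rho> \<sigma> where "\<rho> = (conj_sum + d) / 2" and "\<sigma> = (conj_sum - d) / 2"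
  have d: "d\<^sup>2 = conj_sum\<^sup>2 - 4 * conj_prod" by (simp add: d_def)
  have sum: "\<rho> + \<sigma> = conj_sum" by (simp add: \<rho>_def \<sigma>_def field_simps)
  have "4 * (\<rho> * \<sigma>) = conj_sum\<^sup>2 - d\<^sup>2" by (simp add: \<rho>_def \<sigma>_def field_simps power2_eq_square)
  then have prod: "\<rho> * \<sigma> = conj_prod" unfolding d by simp
  have r: "\<tau> ^ 3 + of_int g2 * \<tau>\<^sup>2 + of_int g1 * \<tau> + of_int g0 = 0" if "(\<tau> - \<rho>) * (\<tau> - \<sigma>) = 0" for \<tau>
  proof -
    have "\<tau>\<^sup>2 - conj_sum * \<tau> + conj_prod = 0"
      using that unfolding sum[symmetric] prod[symmetric] by algebra
    then show ?thesis using root unfolding conj_sum_def conj_prod_def by algebra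
  qed
  have "cofactor b1 b2 b3 = (of_int b1 + of_int b2 * \<rho> + of_int b3 * \<rho>\<^sup>2) *
      (of_int b1 + of_int b2 * \<sigma> + of_int b3 * \<sigma>\<^sup>2)"
    unfolding cofactor_def sum[symmetric] prod[symmetric] of_int_mult of_int_power by algebra
  then have "cofactor b1 b2 b3 \<noteq> 0"
    using root_quadratic_independent[OF r, of \<rho> b1 b2 b3]
      root_quadratic_independent[OF r, of \<sigma> b1 b2 b3] assms by auto
  moreover have "ev b1 b2 b3 \<noteq> 0" using assms by (simp add: ev_eq_0_iff)
  ultimately show ?thesis using ev_mult_cofactor[of b1 b2 b3] by auto
qed

lemma conj_in_int_span: "conj_sum \<in> int_span" "conj_prod \<in> int_span"
  unfolding conj_sum_def conj_prod_def by (intro int_span_intros)+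

lemma cofactor_in_int_span: "cofactor b1 b2 b3 \<in> int_span"
  unfolding cofactor_def by (intro int_span_intros conj_in_int_span)

text \<open>The cofactor is a quadratic form in b1, b2, b3 whose six coefficients are fixed elements
  of Z[\<omega>].\<close>

lemma cofactor_in_coeff_box:
  obtains K where "K > 0"
    "\<And>b1 b2 b3 B. \<bar>real_of_int b1\<bar> \<le> B \<Longrightarrow> \<bar>real_of_int b2\<bar> \<le> B \<Longrightarrow> \<bar>real_of_int b3\<bar> \<le> B
       \<Longrightarrow> cofactor b1 b2 b3 \<in> coeff_box (K * B\<^sup>2)"
proof -
  have ex: "\<exists>K. y \<in> coeff_box K" if "y \<in> int_span" for y using that by (auto simp: int_span_def)
  obtain K0 where K0: "1 \<in> coeff_box K0" using ex int_span_1 by blast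
  obtain K1 where K1: "conj_sum \<in> coeff_box K1" using ex conj_in_int_span by blast
  obtain K2 where K2: "conj_sum\<^sup>2 - 2 * conj_prod \<in> coeff_box K2"
    using ex[of "conj_sum\<^sup>2 - 2 * conj_prod"] by (meson conj_in_int_span int_span_intros)
  obtain K3 where K3: "conj_prod \<in> coeff_box K3" using ex conj_in_int_span by blast
  obtain K4 where K4: "conj_sum * conj_prod \<in> coeff_box K4" using ex conj_in_int_span int_span_mult by meson
  obtain K5 where K5: "conj_prod\<^sup>2 \<in> coeff_box K5" using ex conj_in_int_span int_span_power by meson
  define K where "K = K0 + K1 + K2 + K3 + K4 + K5 + 1"
  note nn = K0[THEN coeff_box_nonneg] K1[THEN coeff_box_nonneg] K2[THEN coeff_box_nonneg] K3[THEN coeff_box_nonneg]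
     K4[THEN coeff_box_nonneg] K5[THEN coeff_box_nonneg]
  show ?thesis
  proof (rule that[of K])
    show "K > 0" using nn by (simp add: K_def)
    fix b1 b2 b3 B
    assume b: "\<bar>real_of_int b1\<bar> \<le> B" "\<bar>real_of_int b2\<bar> \<le> B" "\<bar>real_of_int b3\<bar> \<le> B"
    have bb: "\<bar>real_of_int (x * y)\<bar> \<le> B\<^sup>2" if "\<bar>real_of_int x\<bar> \<le> B" "\<bar>real_of_int y\<bar> \<le> B" for x y
      unfolding of_int_mult abs_mult power2_eq_square using that by (intro mult_mono) auto
    have "of_int (b1 * b1) * 1 + of_int (b1 * b2) * conj_sum
     + of_int (b1 * b3) * (conj_sum\<^sup>2 - 2 * conj_prod) + of_int (b2 * b2) * conj_prod
     + of_int (b2 * b3) * (conj_sum * conj_prod) + of_int (b3 * b3) * conj_prod\<^sup>2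
      \<in> coeff_box (B\<^sup>2 * K0 + B\<^sup>2 * K1 + B\<^sup>2 * K2 + B\<^sup>2 * K3 + B\<^sup>2 * K4 + B\<^sup>2 * K5)"
      by (intro coeff_box_add coeff_box_of_int_mult K0 K1 K2 K3 K4 K5 bb b)
    then have "cofactor b1 b2 b3 \<in> coeff_box (B\<^sup>2 * K0 + B\<^sup>2 * K1 + B\<^sup>2 * K2 + B\<^sup>2 * K3 + B\<^sup>2 * K4 + B\<^sup>2 * K5)"
      by (simp add: cofactor_def power2_eq_square)
    then show "cofactor b1 b2 b3 \<in> coeff_box (K * B\<^sup>2)"
      by (rule coeff_box_mono) (simp add: K_def algebra_simps)
  qed
qed

text \<open>Modulo \<open>p\<^sup>2\<close> the polynomial splits as \<open>(t - R) h(t)\<close>. The cofactor of \<open>\<beta>\<close> is divisible by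
  \<open>\<beta>(R)\<close>, hence by \<open>p\<close>, in the component \<open>\<int>[t]/(p\<^sup>2, h)\<close>; the factor \<open>R - \<omega>\<close> kills the other component.\<close>

lemma square_dvd_cofactor:
  assumes "p\<^sup>2 dvd X - z * R" "p\<^sup>2 dvd R ^ 3 + g2 * R\<^sup>2 + g1 * R + g0"
    and "p dvd b1 + b2 * R + b3 * R\<^sup>2"
  obtains y where "y \<in> int_span"
    "(of_int X - of_int z * \<omega>) * (cofactor b1 b2 b3)\<^sup>2 = of_int (p\<^sup>2) * y"
proof -
  from assms obtain k l m where k: "X - z * R = p\<^sup>2 * k"
    and l: "R ^ 3 + g2 * R\<^sup>2 + g1 * R + g0 = p\<^sup>2 * l"
    and m: "b1 + b2 * R + b3 * R\<^sup>2 = p * m" by (elim dvdE)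
  \<comment> \<open>If R is thought of as one of the two other roots, then \<open>t\<close> is the
    remaining one, and \<open>h\<close>, the value at R of the quadratic with those two roots,
    vanishes. Hence the cofactor is \<beta>(R) \<beta>(t) modulo \<open>h\<close>; \<open>E\<close>
    is the exact quotient.\<close>
  define t where "t = conj_sum - of_int R"
  define \<gamma> where "\<gamma> = of_int b1 + of_int b2 * t + of_int b3 * t\<^sup>2"
  define c where "c = cofactor b1 b2 b3"
  define h where "h = conj_prod - of_int R * t"
  define E where "E = of_int (- 2 * b1 * b3 + b2\<^sup>2) + of_int (b2 * b3) * conj_sum
      + of_int (b3\<^sup>2) * (conj_prod + of_int R * t)"
  have k': "of_int X - of_int z * of_int R = ((of_int p)\<^sup>2 * of_int k :: complex)"
    using arg_cong[OF k, of "of_int :: int \<Rightarrow> complex"] by simp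
  have l': "of_int R ^ 3 + of_int g2 * (of_int R)\<^sup>2 + of_int g1 * of_int R + of_int g0 = ((of_int p)\<^sup>2 * of_int l :: complex)"
    using arg_cong[OF l, of "of_int :: int \<Rightarrow> complex"] by simp
  have m': "of_int b1 + of_int b2 * of_int R + of_int b3 * (of_int R)\<^sup>2 = (of_int p * of_int m :: complex)"
    using arg_cong[OF m, of "of_int :: int \<Rightarrow> complex"] by simp
  have h: "(of_int R - \<omega>) * h = (of_int p)\<^sup>2 * of_int l"
    unfolding l'[symmetric] h_def t_def conj_sum_def conj_prod_def using root by algebra
  have "c - (of_int b1 + of_int b2 * of_int R + of_int b3 * (of_int R)\<^sup>2) * \<gamma> = h * E"
    unfolding c_def cofactor_def \<gamma>_def h_def E_def t_def
      of_int_add of_int_mult of_int_power of_int_minus of_int_numeral by algebra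
  then have c: "c - of_int p * of_int m * \<gamma> = h * E" unfolding m' .
  \<comment> \<open>Substitute X = z R + p^2 k and c^2 = (p m \<gamma>)^2 + h E (c + p m \<gamma>);
    the factor R - \<omega> turns \<open>h\<close> into p^2 l.\<close>
  define y where "y = of_int k * c\<^sup>2 + of_int z * ((of_int R - \<omega>) * of_int m ^ 2 * \<gamma>\<^sup>2
      + of_int l * E * (c + of_int p * of_int m * \<gamma>))"
  have "(of_int X - of_int z * \<omega>) * c\<^sup>2 = (of_int p)\<^sup>2 * y"
    unfolding y_def using k' h c by algebra
  moreover have "y \<in> int_span"
    unfolding y_def c_def E_def \<gamma>_def t_def
    by (intro int_span_intros conj_in_int_span cofactor_in_int_span)
  ultimately show ?thesis using that unfolding c_def by simp
qed

text \<open>With B = p^(1/3) the pigeonhole relation has coordinates at most B and its cofactor c is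
  O(B^2), so (X - z \<omega>) c^2 / p^2 is O(T B^4 / B^6). Multiplying by \<beta>^2 turns c^2 into
  the squared norm.\<close>

lemma ex_small_factorization:
  obtains C where "C > 0"
    "\<And>p X z T. prime p \<Longrightarrow> \<not> p dvd z \<Longrightarrow>
       p\<^sup>2 dvd X ^ 3 + g2 * X\<^sup>2 * z + g1 * X * z\<^sup>2 + g0 * z ^ 3 \<Longrightarrow>
       \<bar>real_of_int X\<bar> \<le> T \<Longrightarrow> \<bar>real_of_int z\<bar> \<le> T \<Longrightarrow>
       \<exists>a1 a2 a3 b1 b2 b3. \<not> (b1 = 0 \<and> b2 = 0 \<and> b3 = 0) \<and>
         (\<forall>b\<in>{b1, b2, b3}. \<bar>real_of_int b\<bar> \<le> real_of_int p powr (1/3)) \<and>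
         (\<forall>a\<in>{a1, a2, a3}. \<bar>real_of_int a\<bar> \<le> C * T * real_of_int p powr (- 2/3)) \<and>
         of_int (p\<^sup>2) * (ev a1 a2 a3 * (ev b1 b2 b3)\<^sup>2) =
           of_int ((nrm b1 b2 b3)\<^sup>2) * (of_int X - of_int z * \<omega>)"
proof -
  obtain M where M: "M > 0"
    "\<And>y y' B B'. y \<in> coeff_box B \<Longrightarrow> y' \<in> coeff_box B' \<Longrightarrow> y * y' \<in> coeff_box (M * B * B')"
    using coeff_box_mult by blast
  obtain K where K: "K > 0"
    "\<And>b1 b2 b3 B. \<bar>real_of_int b1\<bar> \<le> B \<Longrightarrow> \<bar>real_of_int b2\<bar> \<le> B \<Longrightarrow> \<bar>real_of_int b3\<bar> \<le> B
       \<Longrightarrow> cofactor b1 b2 b3 \<in> coeff_box (K * B\<^sup>2)"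
    using cofactor_in_coeff_box by blast
  show ?thesis
  proof (rule that[of "M\<^sup>2 * K\<^sup>2"])
    show "M\<^sup>2 * K\<^sup>2 > 0" using M K by simp
    fix p X z :: int and T :: real
    assume p: "prime p" and pz: "\<not> p dvd z"
      and G: "p\<^sup>2 dvd X ^ 3 + g2 * X\<^sup>2 * z + g1 * X * z\<^sup>2 + g0 * z ^ 3"
      and X: "\<bar>real_of_int X\<bar> \<le> T" and z: "\<bar>real_of_int z\<bar> \<le> T"
    have p0: "p > 0" using p by (simp add: prime_gt_0_int)
    have cop: "coprime z (p\<^sup>2)"
      using p pz by (simp add: prime_imp_coprime coprime_commute)
    then obtain i where i: "[z * i = 1] (mod p\<^sup>2)"
      using cong_solve_coprime_int by blast
    \<comment> \<open>X / z modulo p^2, which is a root of g there.\<close>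
    define R where "R = X * i"
    have "X - z * R = - X * (z * i - 1)" by (simp add: R_def algebra_simps)
    also have "p\<^sup>2 dvd \<dots>" using i by (simp add: cong_iff_dvd_diff)
    finally have XR: "p\<^sup>2 dvd X - z * R" .
    have "z ^ 3 * (R ^ 3 + g2 * R\<^sup>2 + g1 * R + g0) =
       (X ^ 3 + g2 * X\<^sup>2 * z + g1 * X * z\<^sup>2 + g0 * z ^ 3) -
       (X - z * R) * (X\<^sup>2 + X * (z * R) + (z * R)\<^sup>2 + g2 * z * (X + z * R) + g1 * z\<^sup>2)"
      by algebra
    also have "p\<^sup>2 dvd \<dots>" using G XR by (blast intro: dvd_diff dvd_mult2)
    finally have gR: "p\<^sup>2 dvd R ^ 3 + g2 * R\<^sup>2 + g1 * R + g0"
      using cop by (metis coprime_commute coprime_dvd_mult_right_iff coprime_power_right_iff)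
    obtain b1 b2 b3 where b: "\<not> (b1 = 0 \<and> b2 = 0 \<and> b3 = 0)"
      "\<bar>b1\<bar> ^ 3 \<le> p" "\<bar>b2\<bar> ^ 3 \<le> p" "\<bar>b3\<bar> ^ 3 \<le> p" and bR: "p dvd b1 + b2 * R + b3 * R\<^sup>2"
      using ex_small_linear_relation_mod[OF p0] by blast
    define B where "B = real_of_int p powr (1/3)"
    have B0: "B > 0" using p0 by (simp add: B_def)
    have B3: "B ^ 3 = real_of_int p"
      using p0 by (simp add: B_def powr_powr flip: powr_realpow)
    have bB: "\<bar>real_of_int b\<bar> \<le> B" if "\<bar>b\<bar> ^ 3 \<le> p" for b
    proof -
      have "\<bar>real_of_int b\<bar> ^ 3 = real_of_int (\<bar>b\<bar> ^ 3)" by simp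
      also have "\<dots> \<le> B ^ 3" using that unfolding B3 by (simp only: of_int_le_iff)
      finally show ?thesis using B0 by (meson less_imp_le power_le_imp_le_base power_mono_iff zero_less_numeral abs_ge_zero)
    qed
    define c where "c = cofactor b1 b2 b3"
    obtain y where y: "y \<in> int_span" "(of_int X - of_int z * \<omega>) * c\<^sup>2 = of_int (p\<^sup>2) * y"
      using square_dvd_cofactor[OF XR gR bR] unfolding c_def by blast
    obtain a1 a2 a3 where a: "y = ev a1 a2 a3" using y(1) by (rule int_spanE)
    have "c \<in> coeff_box (K * B\<^sup>2)" unfolding c_def using b bB by (intro K) auto
    then have "c * c \<in> coeff_box (M * (K * B\<^sup>2) * (K * B\<^sup>2))" using M by blast
    moreover have "ev X (- z) 0 \<in> coeff_box T" using X z coeff_box_nonneg by (auto simp: ev_in_coeff_box_iff)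
    ultimately have "ev X (- z) 0 * (c * c) \<in> coeff_box (M * T * (M * (K * B\<^sup>2) * (K * B\<^sup>2)))"
      using M by blast
    also have "ev X (- z) 0 * (c * c) = of_int (p\<^sup>2) * y"
      using y(2) by (simp add: ev_def power2_eq_square)
    also have "\<dots> = ev (p\<^sup>2 * a1) (p\<^sup>2 * a2) (p\<^sup>2 * a3)" by (simp add: a ev_def algebra_simps)
    finally have bd: "\<bar>real_of_int (p\<^sup>2 * a)\<bar> \<le> M * T * (M * (K * B\<^sup>2) * (K * B\<^sup>2))"
      if "a \<in> {a1, a2, a3}" for a using that by (auto simp: ev_in_coeff_box_iff)
    have "\<bar>real_of_int a\<bar> \<le> M\<^sup>2 * K\<^sup>2 * T * real_of_int p powr (- 2/3)" if "a \<in> {a1, a2, a3}" for a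
    proof -
      have "real_of_int p powr (- 2/3) = B powr (- 2)" using p0 by (simp add: B_def powr_powr)
      also have "\<dots> = 1 / B\<^sup>2" using B0 by (simp add: powr_minus_divide)
      finally have e: "real_of_int p powr (- 2/3) = 1 / B\<^sup>2" .
      have "B ^ 6 * \<bar>real_of_int a\<bar> = \<bar>real_of_int (p\<^sup>2 * a)\<bar>"
        using B3 by (simp add: abs_mult flip: B3)
      also have "\<dots> \<le> M * T * (M * (K * B\<^sup>2) * (K * B\<^sup>2))" using bd that by blast
      also have "\<dots> = B ^ 6 * (M\<^sup>2 * K\<^sup>2 * T * (1 / B\<^sup>2))"
        using B0 by (simp add: field_simps power2_eq_square eval_nat_numeral)
      finally show ?thesis using B0 unfolding e by (subst (asm) mult_le_cancel_left_pos) auto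
    qed
    moreover have "of_int (p\<^sup>2) * (ev a1 a2 a3 * (ev b1 b2 b3)\<^sup>2) =
           of_int ((nrm b1 b2 b3)\<^sup>2) * (of_int X - of_int z * \<omega>)"
      unfolding of_int_power ev_mult_cofactor[symmetric] a[symmetric] c_def[symmetric]
      using y(2) unfolding of_int_power by algebra
    moreover have "\<forall>b\<in>{b1, b2, b3}. \<bar>real_of_int b\<bar> \<le> real_of_int p powr (1/3)"
      using b bB unfolding B_def by blast
    ultimately show "\<exists>a1 a2 a3 b1 b2 b3. \<not> (b1 = 0 \<and> b2 = 0 \<and> b3 = 0) \<and>
         (\<forall>b\<in>{b1, b2, b3}. \<bar>real_of_int b\<bar> \<le> real_of_int p powr (1/3)) \<and>
         (\<forall>a\<in>{a1, a2, a3}. \<bar>real_of_int a\<bar> \<le> M\<^sup>2 * K\<^sup>2 * T * real_of_int p powr (- 2/3)) \<and>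
         of_int (p\<^sup>2) * (ev a1 a2 a3 * (ev b1 b2 b3)\<^sup>2) =
           of_int ((nrm b1 b2 b3)\<^sup>2) * (of_int X - of_int z * \<omega>)"
      using b(1) by blast
  qed
qed

end

section \<open>Counting points\<close>

text \<open>For counting tuples by fixing the part y and bounding the choices of the part x;
  \<open>h\<close> reassembles the tuple.\<close>

lemma card_le_fibres:
  assumes "finite I" "finite Y" "S \<subseteq> {h x y | x y. x \<in> I \<and> y \<in> Y \<and> P x y}"
    and fib: "\<And>y. y \<in> Y \<Longrightarrow> card {x \<in> I. P x y} \<le> k"
  shows "card S \<le> k * card Y"
proof -
  have "S \<subseteq> (\<Union>y\<in>Y. (\<lambda>x. h x y) ` {x \<in> I. P x y})" using assms(3) by blast
  then have "card S \<le> card (\<Union>y\<in>Y. (\<lambda>x. h x y) ` {x \<in> I. P x y})"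
    using assms(1,2) by (intro card_mono) auto
  also have "\<dots> \<le> (\<Sum>y\<in>Y. card ((\<lambda>x. h x y) ` {x \<in> I. P x y}))"
    using assms(2) by (rule card_UN_le)
  also have "\<dots> \<le> (\<Sum>y\<in>Y. k)"
    using fib assms(1) by (intro sum_mono order_trans[OF card_image_le]) auto
  finally show ?thesis by (simp add: mult.commute)
qed

lemma card_quadratic_roots_le:
  fixes c0 c1 c2 :: "'a::idom"
  assumes "c2 \<noteq> 0"
  shows "card {x \<in> I. c2 * x\<^sup>2 + c1 * x + c0 = 0} \<le> 2"
proof -
  have p: "[:c0, c1, c2:] \<noteq> 0" using assms by simp
  have "card {x \<in> I. c2 * x\<^sup>2 + c1 * x + c0 = 0} \<le> card {x. poly [:c0, c1, c2:] x = 0}"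
    using poly_roots_finite[OF p] by (intro card_mono) (auto simp: algebra_simps power2_eq_square)
  also have "\<dots> \<le> degree [:c0, c1, c2:]" using p by (rule card_poly_roots_bound)
  finally show ?thesis using assms by simp
qed

text \<open>Proportional primitive vectors agree up to sign, as their second coordinates divide each
  other. This is why the codes of points below carry the Boolean 0 < z.\<close>

lemma primitive_vector_unique:
  fixes x z x' z' :: int
  assumes "coprime x z" "coprime x' z'" "x * z' = x' * z" "z \<noteq> 0" "0 < z \<longleftrightarrow> 0 < z'"
  shows "x = x' \<and> z = z'"
proof -
  have "z dvd z'" using assms(1,3) by (metis coprime_commute coprime_dvd_mult_right_iff dvd_triv_right)
  moreover have "z' dvd z" using assms(2,3) by (metis coprime_commute coprime_dvd_mult_right_iff dvd_triv_right)
  ultimately have "\<bar>z\<bar> = \<bar>z'\<bar>" by (rule zdvd_antisym_abs)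
  then have "z = z'" using assms(4,5) by linarith
  then show ?thesis using assms(3,4) by simp
qed

lemma card_int_box_le:
  assumes "0 \<le> B"
  shows "real (card {b::int. \<bar>real_of_int b\<bar> \<le> B}) \<le> 2 * B + 1"
    and "finite {b::int. \<bar>real_of_int b\<bar> \<le> B}"
proof -
  have e: "{b::int. \<bar>real_of_int b\<bar> \<le> B} = {- \<lfloor>B\<rfloor>..\<lfloor>B\<rfloor>}"
  proof (intro set_eqI)
    fix b :: int
    have "- \<lfloor>B\<rfloor> \<le> b \<longleftrightarrow> - real_of_int b \<le> B" using le_floor_iff[of "- b" B] by auto
    then show "b \<in> {b. \<bar>real_of_int b\<bar> \<le> B} \<longleftrightarrow> b \<in> {- \<lfloor>B\<rfloor>..\<lfloor>B\<rfloor>}"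
      by (auto simp: abs_le_iff le_floor_iff)
  qed
  show "real (card {b::int. \<bar>real_of_int b\<bar> \<le> B}) \<le> 2 * B + 1"
    unfolding e using assms by (simp add: of_nat_nat)
  show "finite {b::int. \<bar>real_of_int b\<bar> \<le> B}" unfolding e by simp
qed

section \<open>Integer points on the conic\<close>

context cubic_without_root
begin

text \<open>The coefficient of \<open>\<omega>\<^sup>2\<close> in \<open>\<alpha> \<beta>\<^sup>2\<close>; the matrix of this quadratic form in \<open>\<beta>\<close> is the Hankel
  matrix of the coefficients of \<open>\<omega>\<^sup>2\<close> in \<open>\<alpha>, \<alpha> \<omega>, \<dots>, \<alpha> \<omega>\<^sup>4\<close>.\<close>

definition top_coeff :: "int \<Rightarrow> int \<Rightarrow> int \<Rightarrow> int \<Rightarrow> int \<Rightarrow> int \<Rightarrow> int" where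
  "top_coeff a1 a2 a3 b1 b2 b3 =
    (let u0 = a3; u1 = a2 - g2 * u0; u2 = a1 - g2 * u1 - g1 * u0;
         u3 = - g2 * u2 - g1 * u1 - g0 * u0; u4 = - g2 * u3 - g1 * u2 - g0 * u1
     in u0 * b1\<^sup>2 + 2 * u1 * b1 * b2 + u2 * (b2\<^sup>2 + 2 * b1 * b3) + 2 * u3 * b2 * b3 + u4 * b3\<^sup>2)"

text \<open>The map from (a3, a2, a1) to (u0, u1, u2) is unitriangular, so some u is nonzero. If it
  is u0 or u2, the equation is quadratic in b1 or b2 respectively, with the other two coordinates
  free.\<close>

lemma card_top_coeff_zeros:
  assumes a: "\<not> (a1 = 0 \<and> a2 = 0 \<and> a3 = 0)" and I: "finite I"
  shows "card {(b1, b2, b3). b1 \<in> I \<and> b2 \<in> I \<and> b3 \<in> I \<and> top_coeff a1 a2 a3 b1 b2 b3 = 0}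
    \<le> 2 * (card I)\<^sup>2" (is "card ?S \<le> _")
proof -
  define u0 u1 where "u0 = a3" and "u1 = a2 - g2 * u0"
  define u2 where "u2 = a1 - g2 * u1 - g1 * u0"
  define u3 where "u3 = - g2 * u2 - g1 * u1 - g0 * u0"
  define u4 where "u4 = - g2 * u3 - g1 * u2 - g0 * u1"
  have Q: "top_coeff a1 a2 a3 b1 b2 b3 =
     u0 * b1\<^sup>2 + 2 * u1 * b1 * b2 + u2 * (b2\<^sup>2 + 2 * b1 * b3) + 2 * u3 * b2 * b3 + u4 * b3\<^sup>2" for b1 b2 b3
    by (simp add: top_coeff_def Let_def u0_def u1_def u2_def u3_def u4_def)
  have cI: "card (I \<times> I) = (card I)\<^sup>2" by (simp add: card_cartesian_product power2_eq_square)
  have "u1 \<noteq> 0" if "u0 = 0" "u2 = 0" using a that by (auto simp: u0_def u1_def u2_def)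
  then consider "u0 \<noteq> 0" | "u2 \<noteq> 0" | "u0 = 0" "u2 = 0" "u1 \<noteq> 0" by blast
  then show ?thesis
  proof cases
    case 1
    have "card ?S \<le> 2 * card (I \<times> I)"
    proof (rule card_le_fibres[where I = I and h = "\<lambda>x y. (x, fst y, snd y)" and
        P = "\<lambda>x y. u0 * x\<^sup>2 + (2 * u1 * fst y + 2 * u2 * snd y) * x +
           (u2 * (fst y)\<^sup>2 + 2 * u3 * fst y * snd y + u4 * (snd y)\<^sup>2) = 0"])
      show "?S \<subseteq> {(x, fst y, snd y) | x y. x \<in> I \<and> y \<in> I \<times> I \<and>
         u0 * x\<^sup>2 + (2 * u1 * fst y + 2 * u2 * snd y) * x +
           (u2 * (fst y)\<^sup>2 + 2 * u3 * fst y * snd y + u4 * (snd y)\<^sup>2) = 0}"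
        by (auto simp: Q algebra_simps)
    qed (use I 1 in \<open>auto intro: card_quadratic_roots_le\<close>)
    then show ?thesis unfolding cI .
  next
    case 2
    have "card ?S \<le> 2 * card (I \<times> I)"
    proof (rule card_le_fibres[where I = I and h = "\<lambda>x y. (fst y, x, snd y)" and
        P = "\<lambda>x y. u2 * x\<^sup>2 + (2 * u1 * fst y + 2 * u3 * snd y) * x +
           (u0 * (fst y)\<^sup>2 + 2 * u2 * fst y * snd y + u4 * (snd y)\<^sup>2) = 0"])
      show "?S \<subseteq> {(fst y, x, snd y) | x y. x \<in> I \<and> y \<in> I \<times> I \<and>
         u2 * x\<^sup>2 + (2 * u1 * fst y + 2 * u3 * snd y) * x +
           (u0 * (fst y)\<^sup>2 + 2 * u2 * fst y * snd y + u4 * (snd y)\<^sup>2) = 0}"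
        by (auto simp: Q algebra_simps)
    qed (use I 2 in \<open>auto intro: card_quadratic_roots_le\<close>)
    then show ?thesis unfolding cI .
  next
    case 3
    \<comment> \<open>The plane b2 = 0 is set aside: off it the equation is linear in b1 with
      leading coefficient 2 u1 b2, and the plane contributes at most one triple per pair (b1,
      b3).\<close>
    let ?Z = "(\<lambda>(x, y). (x, 0 :: int, y)) ` (I \<times> I)"
    have fin: "finite ?S" by (rule finite_subset[of _ "I \<times> I \<times> I"]) (use I in auto)
    have "card (?S - ?Z) \<le> 1 * card (I \<times> I)"
    proof (rule card_le_fibres[where I = I and h = "\<lambda>x y. (x, fst y, snd y)" and
        P = "\<lambda>x y. fst y \<noteq> 0 \<and> 2 * u1 * fst y * x + (2 * u3 * fst y * snd y + u4 * (snd y)\<^sup>2) = 0"])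
      show "?S - ?Z \<subseteq> {(x, fst y, snd y) | x y. x \<in> I \<and> y \<in> I \<times> I \<and> fst y \<noteq> 0 \<and>
          2 * u1 * fst y * x + (2 * u3 * fst y * snd y + u4 * (snd y)\<^sup>2) = 0}"
        using 3 by (auto simp: Q algebra_simps image_iff)
      fix y assume "y \<in> I \<times> I"
      have eq: "x = x'" if "fst y \<noteq> 0" "2 * u1 * fst y * x + k = 0" "2 * u1 * fst y * x' + k = 0" for x x' k
      proof -
        have "2 * u1 * fst y * x = 2 * u1 * fst y * x'" using that(2,3) by linarith
        then show ?thesis using that(1) 3(3) by simp
      qed
      have "card {x \<in> I. fst y \<noteq> 0 \<and> 2 * u1 * fst y * x + k = 0} \<le> Suc 0" for k
        by (rule card_le_Suc0_iff_eq[THEN iffD2]) (use I in simp, use eq in blast)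
      then show "card {x \<in> I. fst y \<noteq> 0 \<and> 2 * u1 * fst y * x + (2 * u3 * fst y * snd y + u4 * (snd y)\<^sup>2) = 0} \<le> 1"
        unfolding One_nat_def .
    qed (use I in auto)
    moreover have fin0: "finite ?Z" using I by (intro finite_imageI finite_cartesian_product)
    then have "card ?Z \<le> card (I \<times> I)" using I by (intro card_image_le finite_cartesian_product)
    moreover have "card ?S \<le> card (?S - ?Z) + card ?Z"
    proof -
      have "card ?S \<le> card ((?S - ?Z) \<union> ?Z)"
        using fin fin0 by (intro card_mono finite_UnI finite_Diff) blast+
      also have "\<dots> \<le> card (?S - ?Z) + card ?Z" by (rule card_Un_le)
      finally show ?thesis .
    qed
    ultimately show ?thesis unfolding cI by linarith
  qed
qed

end

context cubic_with_root
begin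

lemma ev_mult_square:
  obtains s t where "ev a1 a2 a3 * (ev b1 b2 b3)\<^sup>2 = ev s t (top_coeff a1 a2 a3 b1 b2 b3)"
proof -
  have "\<exists>s t. ev a1 a2 a3 * (ev b1 b2 b3 * ev b1 b2 b3) = ev s t (top_coeff a1 a2 a3 b1 b2 b3)"
    unfolding ev_mult ev_eq_iff top_coeff_def Let_def
    \<comment> \<open>The two uses of \<open>refl\<close> instantiate s and t by the lower
      coordinates of the product; only the identity for the top one remains.\<close>
    by (intro exI conjI, rule refl, rule refl) algebra
  then show ?thesis using that by (auto simp: power2_eq_square)
qed

end

section \<open>Points on the cubic form, by size of the prime\<close>

locale cubic_form =
  fixes a b c d :: int
  assumes form_no_zero: "a * x ^ 3 + b * x\<^sup>2 * z + c * x * z\<^sup>2 + d * z ^ 3 = 0 \<Longrightarrow> x = 0 \<and> z = 0"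
begin

definition form :: "int \<Rightarrow> int \<Rightarrow> int" where
  "form x z = a * x ^ 3 + b * x\<^sup>2 * z + c * x * z\<^sup>2 + d * z ^ 3"

lemma lead_nonzero: "a \<noteq> 0"
  using form_no_zero[of 1 0] by auto

text \<open>Substituting X = a x makes a^2 f(x, z) monic in X; a zero (u, v) of the monic form
  yields the zero (u, a v) of f.\<close>

sublocale cubic_without_root "a\<^sup>2 * d" "a * c" b
proof
  fix u v :: int
  assume "u ^ 3 + b * u\<^sup>2 * v + a * c * u * v\<^sup>2 + a\<^sup>2 * d * v ^ 3 = 0"
  then have "a\<^sup>2 * (a * u ^ 3 + b * u\<^sup>2 * (a * v) + c * u * (a * v)\<^sup>2 + d * (a * v) ^ 3) = 0"
    by algebra
  then have "a * u ^ 3 + b * u\<^sup>2 * (a * v) + c * u * (a * v)\<^sup>2 + d * (a * v) ^ 3 = 0"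
    using lead_nonzero by simp
  from form_no_zero[OF this] show "u = 0 \<and> v = 0" using lead_nonzero by simp
qed

lemma monic_form: "(a * x) ^ 3 + b * (a * x)\<^sup>2 * z + a * c * (a * x) * z\<^sup>2 + a\<^sup>2 * d * z ^ 3 = a\<^sup>2 * form x z"
  unfolding form_def by algebra

text \<open>Both |a| and |z| are below p, and z = 0 would force x to be 1 or -1, where the form
  takes the values a and -a.\<close>

lemma large_prime_not_dvd:
  assumes p: "prime p" "int N < p" and N: "\<bar>a\<bar> \<le> int N"
    and xz: "\<bar>z\<bar> \<le> int N" "coprime x z" "p\<^sup>2 dvd form x z"
  shows "\<not> p dvd a" "\<not> p dvd z" "z \<noteq> 0"
proof -
  show pa: "\<not> p dvd a"
    using zdvd_imp_le[of p "\<bar>a\<bar>"] p N lead_nonzero by auto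
  show z0: "z \<noteq> 0"
  proof
    assume "z = 0"
    with xz(2) have "x = 1 \<or> x = -1" by auto
    with \<open>z = 0\<close> have "form x z = a \<or> form x z = - a" by (auto simp: form_def)
    with xz(3) have "p\<^sup>2 dvd a" by auto
    then show False using pa by (metis dvd_mult_left power2_eq_square)
  qed
  then show "\<not> p dvd z"
    using zdvd_imp_le[of p "\<bar>z\<bar>"] p xz by auto
qed

text \<open>\<open>P\<close> restricts the witnessing prime, so that medium and large primes can be
  treated apart.\<close>

definition points :: "nat \<Rightarrow> (int \<Rightarrow> bool) \<Rightarrow> (int \<times> int) set" where
  "points N P = {(x, z). \<bar>x\<bar> \<le> int N \<and> \<bar>z\<bar> \<le> int N \<and> coprime x z \<and>
      (\<exists>p. prime p \<and> int N < p \<and> P p \<and> p\<^sup>2 dvd form x z)}"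

lemma finite_points: "finite (points N P)"
  by (rule finite_subset[of _ "{- int N..int N} \<times> {- int N..int N}"]) (auto simp: points_def)

text \<open>A point is encoded by its prime, a root of g modulo it, one of 5 * 5 cells and the sign
  of z: at most M * 3 * 25 * 2 codes.\<close>

lemma card_points_medium_primes:
  assumes N: "N > 0" "\<bar>a\<bar> \<le> int N" "\<bar>disc\<bar> \<le> int N"
  shows "card (points N (\<lambda>p. p \<le> int M)) \<le> 150 * M"
proof -
  let ?S = "points N (\<lambda>p. p \<le> int M)"
  define roots where "roots p = {r \<in> {0..<p}. p dvd r ^ 3 + b * r\<^sup>2 + a * c * r + a\<^sup>2 * d}" for p
  have "\<exists>p r. prime p \<and> int N < p \<and> p \<le> int M \<and> r \<in> roots p \<and> p\<^sup>2 dvd form (fst v) (snd v) \<and>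
      p dvd a * fst v - r * snd v" if "v \<in> ?S" for v
  proof -
    obtain x z where v: "v = (x, z)" by (cases v)
    from that obtain p where p: "prime p" "int N < p" "p \<le> int M" "p\<^sup>2 dvd form x z"
      and xz: "\<bar>x\<bar> \<le> int N" "\<bar>z\<bar> \<le> int N" "coprime x z"
      by (auto simp: points_def v)
    have nd: "\<not> p dvd z" using large_prime_not_dvd p xz N by blast
    then have cop: "coprime z p" using p(1) by (simp add: prime_imp_coprime coprime_commute)
    then obtain i where i: "[z * i = 1] (mod p)" using cong_solve_coprime_int by blast
    \<comment> \<open>The residue of a x / z modulo p, which is the root attached to the
      point.\<close>
    define r where "r = (a * x * i) mod p"
    have "p dvd a * x * i - r" unfolding r_def by (simp add: mod_eq_dvd_iff[symmetric])
    moreover have "p dvd z * i - 1" using i by (simp add: cong_iff_dvd_diff)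
    ultimately have "p dvd z * (a * x * i - r) - a * x * (z * i - 1)" by (metis dvd_diff dvd_mult)
    also have "z * (a * x * i - r) - a * x * (z * i - 1) = a * x - r * z" by algebra
    finally have pr: "p dvd a * x - r * z" .
    have "p dvd form x z" using p(4) by (metis dvd_mult_left power2_eq_square)
    then have "p dvd a\<^sup>2 * form x z - (a * x - r * z) *
       ((a * x)\<^sup>2 + (a * x) * (r * z) + (r * z)\<^sup>2 + b * z * (a * x + r * z) + a * c * z\<^sup>2)"
      using pr by (metis dvd_diff dvd_mult dvd_mult2)
    also have "\<dots> = z ^ 3 * (r ^ 3 + b * r\<^sup>2 + a * c * r + a\<^sup>2 * d)"
      unfolding form_def by algebra
    finally have "p dvd r ^ 3 + b * r\<^sup>2 + a * c * r + a\<^sup>2 * d"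
      using p(1) nd prime_dvd_multD prime_dvd_power by blast
    then have "r \<in> roots p" using prime_gt_0_int[OF p(1)] by (simp add: roots_def r_def)
    with p pr show ?thesis by (auto simp: v)
  qed
  then obtain pr rt where ch: "\<And>v. v \<in> ?S \<Longrightarrow> prime (pr v) \<and> int N < pr v \<and> pr v \<le> int M \<and>
      rt v \<in> roots (pr v) \<and> (pr v)\<^sup>2 dvd form (fst v) (snd v) \<and> pr v dvd a * fst v - rt v * snd v"
    by metis
  define T where "T = (SIGMA p:{p. prime p \<and> p \<le> int M}. roots p) \<times> {0..4::int} \<times> {0..4::int} \<times> (UNIV :: bool set)"
  \<comment> \<open>The cells have side N / 2; the index 4 is reached only by a coordinate equal to
    N.\<close>
  define h where "h v = ((pr v, rt v), (2 * (fst v + int N)) div int N, (2 * (snd v + int N)) div int N, 0 < snd v)" for v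
  have fp: "finite {p. prime p \<and> p \<le> int M}"
    by (rule finite_subset[of _ "{0..int M}"]) (auto dest: prime_ge_0_int)
  have fr: "finite (roots p)" for p unfolding roots_def by (rule finite_subset[of _ "{0..<p}"]) auto
  have finT: "finite T" using fp fr by (auto simp: T_def)
  have "card {p. prime p \<and> p \<le> int M} \<le> card {1..int M}"
    by (intro card_mono) (auto dest: prime_ge_1_int)
  then have cp: "card {p. prime p \<and> p \<le> int M} \<le> M" by simp
  have "card (SIGMA p:{p. prime p \<and> p \<le> int M}. roots p) = (\<Sum>p\<in>{p. prime p \<and> p \<le> int M}. card (roots p))"
    using fp fr by simp
  also have "\<dots> \<le> (\<Sum>p\<in>{p. prime p \<and> p \<le> int M}. 3)"
    unfolding roots_def by (intro sum_mono card_roots_mod_prime) simp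
  also have "\<dots> \<le> 3 * M" using cp by simp
  finally have cT: "card T \<le> 150 * M" by (simp add: T_def card_cartesian_product)
  have cell: "(2 * (y + int N)) div int N \<in> {0..4}" if "\<bar>y\<bar> \<le> int N" for y
  proof -
    have "(2 * (y + int N)) div int N \<le> (4 * int N) div int N" using that N by (intro zdiv_mono1) auto
    moreover have "0 \<le> (2 * (y + int N)) div int N" using that N by (intro pos_imp_zdiv_nonneg_iff[THEN iffD2]) auto
    ultimately show ?thesis using N by simp
  qed
  have same_cell: "\<bar>2 * (y - y')\<bar> \<le> int N"
    if "(2 * (y + int N)) div int N = (2 * (y' + int N)) div int N" for y y'
  proof -
    note same = that
    define q where "q = int N * ((2 * (y' + int N)) div int N)"
    have *: "\<exists>m. 2 * t + 2 * int N = q + m \<and> 0 \<le> m \<and> m < int N"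
      if "(2 * (t + int N)) div int N = (2 * (y' + int N)) div int N" for t
      unfolding q_def that[symmetric] distrib_left[symmetric]
      using N pos_mod_sign[of "int N"] pos_mod_bound[of "int N"]
      by (intro exI[of _ "(2 * (t + int N)) mod int N"] conjI mult_div_mod_eq[symmetric]) simp_all
    obtain m m' where "2 * y + 2 * int N = q + m" "0 \<le> m" "m < int N"
      "2 * y' + 2 * int N = q + m'" "0 \<le> m'" "m' < int N"
      using *[OF same] *[OF refl] by blast
    then show ?thesis unfolding right_diff_distrib by linarith
  qed
  have "inj_on h ?S"
  proof (rule inj_onI)
    fix v v' assume v: "v \<in> ?S" "v' \<in> ?S" and eq: "h v = h v'"
    obtain x z x' z' where vv: "v = (x, z)" "v' = (x', z')" by (cases v; cases v')
    define p where "p = pr v"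
    have e: "pr v' = p" "rt v' = rt v" "(2 * (x + int N)) div int N = (2 * (x' + int N)) div int N"
       "(2 * (z + int N)) div int N = (2 * (z' + int N)) div int N" "0 < z \<longleftrightarrow> 0 < z'"
      using eq by (auto simp: h_def vv p_def)
    have b: "\<bar>x\<bar> \<le> int N" "\<bar>z\<bar> \<le> int N" "coprime x z" "\<bar>x'\<bar> \<le> int N" "\<bar>z'\<bar> \<le> int N" "coprime x' z'"
      using v by (auto simp: points_def vv)
    have p: "prime p" "int N < p" "p\<^sup>2 dvd form x z" "p\<^sup>2 dvd form x' z'"
      "p dvd a * x - rt v * z" "p dvd a * x' - rt v * z'"
      using ch[OF v(1)] ch[OF v(2)] e by (auto simp: p_def vv)
    have nd: "\<not> p dvd a" "\<not> p dvd z" "\<not> p dvd z'" "z \<noteq> 0"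
      using large_prime_not_dvd p b N by blast+
    have "\<not> p dvd disc"
      using zdvd_imp_le[of p "\<bar>disc\<bar>"] p N disc_nonzero by auto
    moreover have "p dvd (a * x) * z' - (a * x') * z"
    proof -
      have "(a * x) * z' - (a * x') * z = (a * x - rt v * z) * z' - (a * x' - rt v * z') * z" by algebra
      then show ?thesis using p(5,6) by (metis dvd_diff dvd_mult2)
    qed
    ultimately have "p\<^sup>2 dvd (a * x) * z' - (a * x') * z"
      using p nd by (intro hensel) (auto simp: monic_form)
    also have "\<dots> = a * (x * z' - x' * z)" by algebra
    finally have pw: "p\<^sup>2 dvd x * z' - x' * z"
      using p(1) nd(1) by (metis coprime_commute coprime_dvd_mult_right_iff coprime_power_right_iff prime_imp_coprime)
    \<comment> \<open>Within a cell the coordinates differ by at most N / 2, so the determinant,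
      written through these differences, is at most N^2 < p^2 in absolute value and must
      vanish.\<close>
    have "2 * (x * z' - x' * z) = 2 * (x - x') * z' - 2 * (z - z') * x'" by algebra
    then have "2 * \<bar>x * z' - x' * z\<bar> = \<bar>2 * (x - x') * z' - 2 * (z - z') * x'\<bar>"
      by (metis abs_mult abs_numeral)
    also have "\<dots> \<le> \<bar>2 * (x - x')\<bar> * \<bar>z'\<bar> + \<bar>2 * (z - z')\<bar> * \<bar>x'\<bar>"
      unfolding abs_mult[symmetric] by (rule abs_triangle_ineq4)
    also have "\<dots> \<le> int N * int N + int N * int N"
      using same_cell[OF e(3)] same_cell[OF e(4)] b by (intro add_mono mult_mono) auto
    also have "\<dots> < 2 * p\<^sup>2"
      using p(2) by (simp add: power2_eq_square mult_strict_mono)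
    finally have "\<bar>x * z' - x' * z\<bar> < p\<^sup>2" by simp
    then have "x * z' - x' * z = 0" using pw zdvd_imp_le[of "p\<^sup>2" "\<bar>x * z' - x' * z\<bar>"] by auto
    then show "v = v'" using primitive_vector_unique[of x z x' z'] b nd e by (simp add: vv)
  qed
  moreover have "h ` ?S \<subseteq> T"
  proof
    fix w assume "w \<in> h ` ?S"
    then obtain x z where v: "(x, z) \<in> ?S" "w = h (x, z)" by auto
    then have "\<bar>x\<bar> \<le> int N" "\<bar>z\<bar> \<le> int N" by (auto simp: points_def)
    then show "w \<in> T" using ch[OF v(1)] cell[of x] cell[of z] by (simp add: v(2) h_def T_def)
  qed
  ultimately have "card ?S \<le> card T" using finT card_inj_on_le by blast
  with cT show ?thesis by linarith
qed

text \<open>The code of a point is (\<alpha>, \<beta>) with the sign of z; the prime itself is not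
  recorded. There are O(N^(1/3)) choices of \<alpha>, and for each nonzero one the conic carries
  O(N) choices of \<beta>.\<close>

lemma card_points_large_primes:
  obtains C where "\<And>N. N > 0 \<Longrightarrow> \<bar>a\<bar> \<le> int N \<Longrightarrow>
    real (card (points N (\<lambda>p. real N powr (4/3) < real_of_int p))) \<le> C * real N powr (4/3)"
proof -
  have "\<exists>\<omega>. poly [:of_int (a\<^sup>2 * d), of_int (a * c), of_int b, 1:] \<omega> = (0::complex)"
    by (rule fundamental_theorem_of_algebra_alt) simp
  then obtain \<omega> :: complex where w: "poly [:of_int (a\<^sup>2 * d), of_int (a * c), of_int b, 1:] \<omega> = 0" ..
  interpret cubic_with_root "a\<^sup>2 * d" "a * c" b \<omega>
    by unfold_locales (use w in \<open>simp add: algebra_simps power2_eq_square power3_eq_cube\<close>)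
  obtain C where C: "C > 0" and small: "\<And>p X z T. prime p \<Longrightarrow> \<not> p dvd z \<Longrightarrow>
       p\<^sup>2 dvd X ^ 3 + b * X\<^sup>2 * z + a * c * X * z\<^sup>2 + a\<^sup>2 * d * z ^ 3 \<Longrightarrow>
       \<bar>real_of_int X\<bar> \<le> T \<Longrightarrow> \<bar>real_of_int z\<bar> \<le> T \<Longrightarrow>
       \<exists>a1 a2 a3 b1 b2 b3. \<not> (b1 = 0 \<and> b2 = 0 \<and> b3 = 0) \<and>
         (\<forall>b\<in>{b1, b2, b3}. \<bar>real_of_int b\<bar> \<le> real_of_int p powr (1/3)) \<and>
         (\<forall>a\<in>{a1, a2, a3}. \<bar>real_of_int a\<bar> \<le> C * T * real_of_int p powr (- 2/3)) \<and>
         of_int (p\<^sup>2) * (ev a1 a2 a3 * (ev b1 b2 b3)\<^sup>2) =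
           of_int ((nrm b1 b2 b3)\<^sup>2) * (of_int X - of_int z * \<omega>)"
    using ex_small_factorization by blast
  \<comment> \<open>On the box |f(x, z)| is at most H N^3, so p^2 divides a nonzero value of that
    size and p^(1/3) is at most H^(1/6) N^(1/2).\<close>
  define H where "H = real_of_int (\<bar>a\<bar> + \<bar>b\<bar> + \<bar>c\<bar> + \<bar>d\<bar>)"
  define CA where "CA = C * (\<bar>real_of_int a\<bar> + 1)"
  define CB where "CB = H powr (1/6)"
  have CA: "CA \<ge> 0" using C by (simp add: CA_def)
  have CB: "CB \<ge> 0" by (simp add: CB_def)
  \<comment> \<open>The factor 4 is 2 from the count on the conic times 2 for the sign of z.\<close>
  define K where "K = 4 * (2 * CA + 1) ^ 3 * (2 * CB + 1) ^ 2"
  show ?thesis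
  proof (rule that[of K])
    fix N :: nat assume N: "N > 0" "\<bar>a\<bar> \<le> int N"
    let ?S = "points N (\<lambda>p. real N powr (4/3) < real_of_int p)"
    define A where "A = {t::int. \<bar>real_of_int t\<bar> \<le> CA * real N powr (1/9)}"
    define B where "B = {t::int. \<bar>real_of_int t\<bar> \<le> CB * real N powr (1/2)}"
    define T where "T = {(\<alpha>, \<beta>). \<alpha> \<in> A \<times> A \<times> A \<and> \<beta> \<in> B \<times> B \<times> B \<and> \<alpha> \<noteq> (0, 0, 0) \<and>
       top_coeff (fst \<alpha>) (fst (snd \<alpha>)) (snd (snd \<alpha>)) (fst \<beta>) (fst (snd \<beta>)) (snd (snd \<beta>)) = 0}"
    have finAB: "finite A" "finite B"
      unfolding A_def B_def using CA CB by (auto intro!: card_int_box_le(2))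
    have N1: "1 \<le> real N powr e" if "e \<ge> 0" for e using N that by (simp add: ge_one_powr_ge_zero)
    have cA: "real (card A) \<le> (2 * CA + 1) * real N powr (1/9)"
      using card_int_box_le(1)[of "CA * real N powr (1/9)"] CA N1[of "1/9"]
      by (simp add: A_def algebra_simps)
    have cB: "real (card B) \<le> (2 * CB + 1) * real N powr (1/2)"
      using card_int_box_le(1)[of "CB * real N powr (1/2)"] CB N1[of "1/2"]
      by (simp add: B_def algebra_simps)
    have finT: "finite T"
      by (rule finite_subset[of _ "(A \<times> A \<times> A) \<times> (B \<times> B \<times> B)"]) (use finAB in \<open>auto simp: T_def\<close>)
    have "card T \<le> 2 * (card B)\<^sup>2 * card (A \<times> A \<times> A)"
    proof (rule card_le_fibres[where I = "B \<times> B \<times> B" and h = "\<lambda>\<beta> \<alpha>. (\<alpha>, \<beta>)" and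
       P = "\<lambda>\<beta> \<alpha>. \<alpha> \<noteq> (0, 0, 0) \<and>
       top_coeff (fst \<alpha>) (fst (snd \<alpha>)) (snd (snd \<alpha>)) (fst \<beta>) (fst (snd \<beta>)) (snd (snd \<beta>)) = 0"])
      fix \<alpha> :: "int \<times> int \<times> int"
      obtain a1 a2 a3 where \<alpha>: "\<alpha> = (a1, a2, a3)" by (cases \<alpha>)
      show "card {\<beta> \<in> B \<times> B \<times> B. \<alpha> \<noteq> (0, 0, 0) \<and> top_coeff (fst \<alpha>) (fst (snd \<alpha>)) (snd (snd \<alpha>))
          (fst \<beta>) (fst (snd \<beta>)) (snd (snd \<beta>)) = 0} \<le> 2 * (card B)\<^sup>2"
      proof (cases "\<alpha> = (0, 0, 0)")
        case False
        have "{\<beta> \<in> B \<times> B \<times> B. \<alpha> \<noteq> (0, 0, 0) \<and> top_coeff (fst \<alpha>) (fst (snd \<alpha>)) (snd (snd \<alpha>))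
          (fst \<beta>) (fst (snd \<beta>)) (snd (snd \<beta>)) = 0} =
          {(b1, b2, b3). b1 \<in> B \<and> b2 \<in> B \<and> b3 \<in> B \<and> top_coeff a1 a2 a3 b1 b2 b3 = 0}"
          using False by (auto simp: \<alpha>)
        moreover have "\<not> (a1 = 0 \<and> a2 = 0 \<and> a3 = 0)" using False by (simp add: \<alpha>)
        ultimately show ?thesis using card_top_coeff_zeros[OF _ finAB(2)] by simp
      qed simp
    qed (use finAB in \<open>auto simp: T_def\<close>)
    then have "real (card T) \<le> real (2 * (card B)\<^sup>2 * card (A \<times> A \<times> A))" by (simp only: of_nat_le_iff)
    also have "\<dots> = 2 * real (card B) ^ 2 * real (card A) ^ 3"
      by (simp add: card_cartesian_product power3_eq_cube)
    also have "\<dots> \<le> 2 * ((2 * CB + 1) * real N powr (1/2)) ^ 2 * ((2 * CA + 1) * real N powr (1/9)) ^ 3"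
      using cA cB CA CB by (intro mult_mono power_mono) auto
    also have "\<dots> = K / 2 * ((real N powr (1/2)) ^ 2 * (real N powr (1/9)) ^ 3)"
      by (simp add: K_def power_mult_distrib)
    also have "(real N powr (1/2)) ^ 2 * (real N powr (1/9)) ^ 3 = real N powr 1 * real N powr (1/3)"
      using N by (simp add: powr_powr flip: powr_realpow)
    also have "\<dots> = real N powr (4/3)" by (simp only: powr_add[symmetric]) simp
    finally have cT: "real (card T) \<le> K / 2 * real N powr (4/3)" .

    have "\<exists>p \<alpha> \<beta>. (\<alpha>, \<beta>) \<in> T \<and> p \<noteq> 0 \<and> nrm (fst \<beta>) (fst (snd \<beta>)) (snd (snd \<beta>)) \<noteq> 0 \<and> snd v \<noteq> 0 \<and>
       of_int (p\<^sup>2) * (ev (fst \<alpha>) (fst (snd \<alpha>)) (snd (snd \<alpha>)) * (ev (fst \<beta>) (fst (snd \<beta>)) (snd (snd \<beta>)))\<^sup>2) =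
       of_int ((nrm (fst \<beta>) (fst (snd \<beta>)) (snd (snd \<beta>)))\<^sup>2) * (of_int (a * fst v) - of_int (snd v) * \<omega>)"
      if "v \<in> ?S" for v
    proof -
      obtain x z where v: "v = (x, z)" by (cases v)
      from that obtain p where p: "prime p" "int N < p" "real N powr (4/3) < real_of_int p" "p\<^sup>2 dvd form x z"
        and xz: "\<bar>x\<bar> \<le> int N" "\<bar>z\<bar> \<le> int N" "coprime x z"
        by (auto simp: points_def v)
      have nd: "\<not> p dvd z" "z \<noteq> 0" using large_prime_not_dvd p xz N by blast+
      have p0: "p > 0" using prime_gt_0_int p by blast
      have z: "\<bar>real_of_int z\<bar> \<le> real N" and x: "\<bar>real_of_int x\<bar> \<le> real N" using xz by linarith+
      have "form x z \<noteq> 0" using form_no_zero[of x z] nd by (auto simp: form_def)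
      then have "p\<^sup>2 \<le> \<bar>form x z\<bar>" using p(4) zdvd_imp_le[of "p\<^sup>2" "\<bar>form x z\<bar>"] by auto
      then have "real_of_int p ^ 2 \<le> \<bar>real_of_int (form x z)\<bar>"
        by (metis of_int_abs of_int_le_iff of_int_power)
      also have "\<dots> \<le> \<bar>real_of_int a\<bar> * (real N ^ 3) + \<bar>real_of_int b\<bar> * (real N ^ 3)
           + \<bar>real_of_int c\<bar> * (real N ^ 3) + \<bar>real_of_int d\<bar> * (real N ^ 3)"
      proof -
        have m: "\<bar>x1 * x2 * x3 * x4\<bar> \<le> \<bar>x1\<bar> * real N ^ 3"
          if "\<bar>x2\<bar> \<le> real N" "\<bar>x3\<bar> \<le> real N" "\<bar>x4\<bar> \<le> real N" for x1 x2 x3 x4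
          unfolding abs_mult power3_eq_cube mult.assoc using that by (intro mult_mono) auto
        have "real_of_int (form x z) = real_of_int a * x * x * x + real_of_int b * x * x * z
             + real_of_int c * x * z * z + real_of_int d * z * z * z"
          by (simp add: form_def power2_eq_square power3_eq_cube algebra_simps)
        then show ?thesis using m[OF x x x, of a] m[OF x x z, of b] m[OF x z z, of c] m[OF z z z, of d]
          by linarith
      qed
      also have "\<dots> = H * real N ^ 3" by (simp add: H_def algebra_simps)
      finally have pH: "real_of_int p ^ 2 \<le> H * real N ^ 3" .
      have "real_of_int p powr (1/3) = (real_of_int p ^ 2) powr (1/6)"
      proof -
        have "real_of_int p ^ 2 = real_of_int p powr 2" using p0 by simp
        then show ?thesis by (simp only: powr_powr) simp
      qed
      also have "\<dots> \<le> (H * real N ^ 3) powr (1/6)" using pH by (intro powr_mono2) auto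
      also have "\<dots> = CB * real N powr (1/2)"
      proof -
        have "real N ^ 3 = real N powr 3" using N by simp
        then show ?thesis by (simp only: powr_mult powr_powr CB_def) simp
      qed
      finally have pB: "real_of_int p powr (1/3) \<le> CB * real N powr (1/2)" .
      \<comment> \<open>A common bound for |a x| and |z|. Since p > N^(4/3), the size T0 p^(-2/3) of
        \<alpha> is O(N^(1/9)).\<close>
      define T0 where "T0 = (\<bar>real_of_int a\<bar> + 1) * real N"
      have "real_of_int p powr (- 2/3) \<le> (real N powr (4/3)) powr (- 2/3)"
        using p(3) N by (intro powr_mono2') auto
      also have "\<dots> = real N powr (- 8/9)" by (simp add: powr_powr)
      finally have "C * T0 * real_of_int p powr (- 2/3) \<le> C * T0 * real N powr (- 8/9)"
        using C by (intro mult_left_mono) (auto simp: T0_def)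
      also have "\<dots> = CA * (real N powr 1 * real N powr (- 8/9))"
        using N by (simp add: T0_def CA_def)
      also have "\<dots> = CA * real N powr (1/9)" by (simp only: powr_add[symmetric]) simp
      finally have pA: "C * T0 * real_of_int p powr (- 2/3) \<le> CA * real N powr (1/9)" .
      have "\<bar>real_of_int (a * x)\<bar> \<le> T0"
      proof -
        have "\<bar>real_of_int (a * x)\<bar> \<le> \<bar>real_of_int a\<bar> * real N"
          unfolding of_int_mult abs_mult using x by (intro mult_mono) auto
        then show ?thesis by (simp add: T0_def algebra_simps)
      qed
      note xT = this
      have zT: "\<bar>real_of_int z\<bar> \<le> T0"
      proof -
        have "0 \<le> \<bar>real_of_int a\<bar> * real N" by simp
        then show ?thesis using z unfolding T0_def distrib_right by linarith
      qed
      have G: "p\<^sup>2 dvd (a * x) ^ 3 + b * (a * x)\<^sup>2 * z + a * c * (a * x) * z\<^sup>2 + a\<^sup>2 * d * z ^ 3"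
        unfolding monic_form using p(4) by simp
      from small[OF p(1) nd(1) G xT zT] obtain a1 a2 a3 b1 b2 b3 where ab: "\<not> (b1 = 0 \<and> b2 = 0 \<and> b3 = 0)"
         "\<forall>b\<in>{b1, b2, b3}. \<bar>real_of_int b\<bar> \<le> real_of_int p powr (1/3)"
         "\<forall>a\<in>{a1, a2, a3}. \<bar>real_of_int a\<bar> \<le> C * T0 * real_of_int p powr (- 2/3)"
         "of_int (p\<^sup>2) * (ev a1 a2 a3 * (ev b1 b2 b3)\<^sup>2) =
           of_int ((nrm b1 b2 b3)\<^sup>2) * (of_int (a * x) - of_int z * \<omega>)"
        by (elim exE conjE) (rule that)
      have n0: "nrm b1 b2 b3 \<noteq> 0" using nrm_nonzero ab(1) by blast
      have e: "of_int ((nrm b1 b2 b3)\<^sup>2) * (of_int (a * x) - of_int z * \<omega>) =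
         ev ((nrm b1 b2 b3)\<^sup>2 * (a * x)) (- (nrm b1 b2 b3)\<^sup>2 * z) 0"
        by (simp add: ev_def algebra_simps)
      obtain s t where st: "ev a1 a2 a3 * (ev b1 b2 b3)\<^sup>2 = ev s t (top_coeff a1 a2 a3 b1 b2 b3)"
        by (rule ev_mult_square)
      have "of_int (p\<^sup>2) * ev s t (top_coeff a1 a2 a3 b1 b2 b3) =
         ev (p\<^sup>2 * s) (p\<^sup>2 * t) (p\<^sup>2 * top_coeff a1 a2 a3 b1 b2 b3)"
        by (simp add: ev_def algebra_simps)
      \<comment> \<open>X - z \<omega> has no \<omega>^2-coordinate, so that of \<alpha> \<beta>^2
        vanishes: this is the conic. The \<omega>-coordinate shows below that \<alpha> is nonzero,
        as z is.\<close>
      then have st': "p\<^sup>2 * t = - (nrm b1 b2 b3)\<^sup>2 * z" "p\<^sup>2 * top_coeff a1 a2 a3 b1 b2 b3 = 0"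
        using ab(4) unfolding st e by (simp_all add: ev_eq_iff)
      have "ev a1 a2 a3 \<noteq> 0"
      proof
        assume "ev a1 a2 a3 = 0"
        then have "t = 0" using st ev_eq_0_iff[of s t] by simp
        then show False using st'(1) n0 nd by simp
      qed
      then have "(a1, a2, a3) \<noteq> (0, 0, 0)" by (simp add: ev_eq_0_iff)
      moreover have "a1 \<in> A" "a2 \<in> A" "a3 \<in> A"
        unfolding A_def mem_Collect_eq by (rule order_trans[OF bspec[OF ab(3)] pA], simp)+
      moreover have "b1 \<in> B" "b2 \<in> B" "b3 \<in> B"
        unfolding B_def mem_Collect_eq by (rule order_trans[OF bspec[OF ab(2)] pB], simp)+
      moreover have "top_coeff a1 a2 a3 b1 b2 b3 = 0" using st'(2) p0 by simp
      ultimately have "((a1, a2, a3), (b1, b2, b3)) \<in> T" by (simp add: T_def)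
      then show ?thesis using ab(4) n0 nd p0
        by (intro exI[of _ p] exI[of _ "(a1, a2, a3)"] exI[of _ "(b1, b2, b3)"]) (simp add: v)
    qed
    then obtain pr al be where ch: "\<And>v. v \<in> ?S \<Longrightarrow> (al v, be v) \<in> T \<and> pr v \<noteq> (0::int) \<and>
       nrm (fst (be v)) (fst (snd (be v))) (snd (snd (be v))) \<noteq> 0 \<and> snd v \<noteq> 0 \<and>
       of_int ((pr v)\<^sup>2) * (ev (fst (al v)) (fst (snd (al v))) (snd (snd (al v))) * (ev (fst (be v)) (fst (snd (be v))) (snd (snd (be v))))\<^sup>2) =
       of_int ((nrm (fst (be v)) (fst (snd (be v))) (snd (snd (be v))))\<^sup>2) * (of_int (a * fst v) - of_int (snd v) * \<omega>)"
      by metis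
    have "inj_on (\<lambda>v. ((al v, be v), 0 < snd v)) ?S"
    proof (rule inj_onI)
      fix v v' assume v: "v \<in> ?S" "v' \<in> ?S" and eq: "((al v, be v), 0 < snd v) = ((al v', be v'), 0 < snd v')"
      obtain x z x' z' where vv: "v = (x, z)" "v' = (x', z')" by (cases v; cases v')
      define n where "n = nrm (fst (be v)) (fst (snd (be v))) (snd (snd (be v)))"
      define E where "E = ev (fst (al v)) (fst (snd (al v))) (snd (snd (al v))) * (ev (fst (be v)) (fst (snd (be v))) (snd (snd (be v))))\<^sup>2"
      define p p' where "p = pr v" and "p' = pr v'"
      have 1: "of_int (p\<^sup>2) * E = of_int (n\<^sup>2) * (of_int (a * x) - of_int z * \<omega>)" "p \<noteq> 0" "n \<noteq> 0" "z \<noteq> 0"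
        using ch[OF v(1)] by (auto simp: vv p_def n_def E_def)
      have 2: "of_int (p'\<^sup>2) * E = of_int (n\<^sup>2) * (of_int (a * x') - of_int z' * \<omega>)" "p' \<noteq> 0"
        using ch[OF v(2)] eq by (auto simp: vv p'_def n_def E_def)
      \<comment> \<open>Equal codes share \<open>E\<close> and \<open>n\<close>, possibly with
        different primes. Eliminating \<open>E\<close> makes the two linear forms rational multiples
        of each other.\<close>
      have "of_int (n\<^sup>2) * ev (p'\<^sup>2 * (a * x)) (- (p'\<^sup>2 * z)) 0 = of_int (p'\<^sup>2) * (of_int (p\<^sup>2) * E)"
        unfolding 1(1) by (simp add: ev_def algebra_simps)
      also have "\<dots> = of_int (p\<^sup>2) * (of_int (p'\<^sup>2) * E)" by simp
      also have "\<dots> = of_int (n\<^sup>2) * ev (p\<^sup>2 * (a * x')) (- (p\<^sup>2 * z')) 0"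
        unfolding 2(1) by (simp add: ev_def algebra_simps)
      finally have "ev (p'\<^sup>2 * (a * x)) (- (p'\<^sup>2 * z)) 0 = ev (p\<^sup>2 * (a * x')) (- (p\<^sup>2 * z')) 0"
        using 1(3) by simp
      then have e: "p'\<^sup>2 * (a * x) = p\<^sup>2 * (a * x')" "p'\<^sup>2 * z = p\<^sup>2 * z'" by (simp_all add: ev_eq_iff)
      have "(p\<^sup>2 * a) * (x * z') = (p'\<^sup>2 * z) * (a * x)" unfolding e(2) by algebra
      also have "\<dots> = (p\<^sup>2 * a) * (x' * z)" using e(1) by algebra
      finally have "x * z' = x' * z" using 1 lead_nonzero by simp
      moreover have "coprime x z" "coprime x' z'" using v by (auto simp: vv points_def)
      ultimately show "v = v'" using primitive_vector_unique[of x z x' z'] 1(4) eq by (simp add: vv)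
    qed
    moreover have "(\<lambda>v. ((al v, be v), 0 < snd v)) ` ?S \<subseteq> T \<times> UNIV" using ch by auto
    ultimately have "card ?S \<le> card (T \<times> (UNIV :: bool set))"
      using finT by (intro card_inj_on_le) auto
    then have "real (card ?S) \<le> 2 * real (card T)" by (simp add: card_cartesian_product)
    with cT show "real (card ?S) \<le> K * real N powr (4/3)" by simp
  qed
qed

end

section \<open>Combining medium and large primes\<close>

theorem proposition4p3p13:
  fixes f :: "int poly poly"
  assumes "homogeneous2 3 f"
    and "irreducible f"
  shows "\<exists>A C :: real. \<forall>N::nat. N \<ge> 2 \<longrightarrow>
           real (delta f N) \<le> C * (real N powr (4/3) * ln (real N) powr A)"
proof -
  obtain a b c d where f: "f = [:[:0,0,0,a:], [:0,0,b:], [:0,c:], [:d:]:]"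
    using homogeneous_cubic_form[OF assms(1)] by blast
  interpret cubic_form a b c d
    using irreducible_cubic_form_no_zero[OF assms(2)[unfolded f]] by unfold_locales
  obtain K where K: "\<And>N. N > 0 \<Longrightarrow> \<bar>a\<bar> \<le> int N \<Longrightarrow>
    real (card (points N (\<lambda>p. real N powr (4/3) < real_of_int p))) \<le> K * real N powr (4/3)"
    using card_points_large_primes by blast
  \<comment> \<open>From N0 on, every prime p > N is coprime to \<open>a\<close> and
    \<open>disc\<close>. Smaller N are absorbed into \<open>C\<close> by the trivial bound (2 N0 +
    1)^2.\<close>
  define N0 where "N0 = nat (\<bar>a\<bar> + \<bar>disc\<bar>)"
  define C where "C = 150 + \<bar>K\<bar> + (2 * real N0 + 1)\<^sup>2"
  have ex_prime: "(\<exists>p::nat. prime p \<and> N < p \<and> (int p)\<^sup>2 dvd y) \<longleftrightarrow>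
      (\<exists>p::int. prime p \<and> int N < p \<and> p\<^sup>2 dvd y)" for N y
  proof
    assume "\<exists>p::int. prime p \<and> int N < p \<and> p\<^sup>2 dvd y"
    then obtain p where p: "prime p" "int N < p" "p\<^sup>2 dvd y" by blast
    have "int (nat p) = p" using p(2) by simp
    with p show "\<exists>p::nat. prime p \<and> N < p \<and> (int p)\<^sup>2 dvd y"
      by (intro exI[of _ "nat p"]) (simp flip: prime_int_nat_transfer)
  next
    assume "\<exists>p::nat. prime p \<and> N < p \<and> (int p)\<^sup>2 dvd y"
    then obtain p :: nat where "prime p" "N < p" "(int p)\<^sup>2 dvd y" by blast
    then show "\<exists>p::int. prime p \<and> int N < p \<and> p\<^sup>2 dvd y"
      by (intro exI[of _ "int p"]) simp
  qed
  have delta: "delta f N = card (points N (\<lambda>_. True))" for N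
  proof -
    have "large_square_points f N = points N (\<lambda>_. True)"
      unfolding large_square_points_def points_def f eval2_cubic_form form_def
      by (simp add: coprime_iff_gcd_eq_1 ex_prime)
    then show ?thesis by (simp add: delta_def)
  qed
  \<comment> \<open>The exponent A = 0 suffices; N \<ge> 2 keeps \<open>ln (real N)\<close> away
    from 0, so its power \<open>powr 0\<close> is 1.\<close>
  have "real (delta f N) \<le> C * (real N powr (4/3) * ln (real N) powr 0)" if N: "N \<ge> 2" for N
  proof -
    have N1: "1 \<le> real N powr (4/3)" using N by (simp add: ge_one_powr_ge_zero)
    have "real (delta f N) \<le> C * real N powr (4/3)"
    proof (cases "N0 \<le> N")
      case True
      then have big: "\<bar>a\<bar> \<le> int N" "\<bar>disc\<bar> \<le> int N" by (auto simp: N0_def)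
      \<comment> \<open>The integer part of N^(4/3), so that every integer prime falls into one of
        the two ranges.\<close>
      define M where "M = nat \<lfloor>real N powr (4/3)\<rfloor>"
      have "points N (\<lambda>_. True) \<subseteq> points N (\<lambda>p. p \<le> int M) \<union>
          points N (\<lambda>p. real N powr (4/3) < real_of_int p)"
      proof -
        have dich: "p \<le> int M \<or> real N powr (4/3) < real_of_int p" for p
          unfolding M_def by (simp add: le_floor_iff not_less[symmetric]) linarith
        show ?thesis
        proof
          fix v assume "v \<in> points N (\<lambda>_. True)"
          then obtain p where p: "prime p" "int N < p" "p\<^sup>2 dvd form (fst v) (snd v)"
            and v: "\<bar>fst v\<bar> \<le> int N" "\<bar>snd v\<bar> \<le> int N" "coprime (fst v) (snd v)"
            by (auto simp: points_def)
          show "v \<in> points N (\<lambda>p. p \<le> int M) \<union>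
              points N (\<lambda>p. real N powr (4/3) < real_of_int p)"
            unfolding points_def case_prod_beta Un_iff mem_Collect_eq using dich[of p] p v by blast
        qed
      qed
      then have "delta f N \<le> card (points N (\<lambda>p. p \<le> int M) \<union>
          points N (\<lambda>p. real N powr (4/3) < real_of_int p))"
        unfolding delta by (intro card_mono finite_UnI finite_points)
      also have "\<dots> \<le> card (points N (\<lambda>p. p \<le> int M)) + card (points N (\<lambda>p. real N powr (4/3) < real_of_int p))"
        by (rule card_Un_le)
      also have "\<dots> \<le> 150 * M + card (points N (\<lambda>p. real N powr (4/3) < real_of_int p))"
        using card_points_medium_primes big N by simp
      finally have "real (delta f N) \<le> 150 * real M + real (card (points N (\<lambda>p. real N powr (4/3) < real_of_int p)))"
        by linarith
      also have "\<dots> \<le> 150 * real N powr (4/3) + K * real N powr (4/3)"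
        using K[of N] big N by (intro add_mono mult_left_mono) (auto simp: M_def)
      also have "\<dots> = (150 + K) * real N powr (4/3)" by (simp add: algebra_simps)
      also have "\<dots> \<le> C * real N powr (4/3)"
      proof (rule mult_right_mono)
        show "150 + K \<le> C" unfolding C_def using zero_le_power2[of "2 * real N0 + 1"] by linarith
      qed simp
      finally show ?thesis .
    next
      case False
      have "delta f N \<le> card ({- int N..int N} \<times> {- int N..int N})"
        unfolding delta by (intro card_mono) (auto simp: points_def)
      also have "\<dots> = (2 * N + 1)\<^sup>2"
        by (simp add: card_cartesian_product power2_eq_square nat_add_distrib nat_mult_distrib)
      finally have "real (delta f N) \<le> (2 * real N + 1)\<^sup>2"
        by (metis (mono_tags) of_nat_1 of_nat_add of_nat_le_iff of_nat_mult of_nat_numeral of_nat_power)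
      also have "\<dots> \<le> (2 * real N0 + 1)\<^sup>2" using False by (intro power_mono) auto
      also have "\<dots> \<le> C * 1" by (simp add: C_def)
      also have "\<dots> \<le> C * real N powr (4/3)" using N1 by (intro mult_left_mono) (auto simp: C_def)
      finally show ?thesis .
    qed
    then show ?thesis using N by simp
  qed
  then show ?thesis by blast
qed

end
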